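(* Let $(S,\prec)$ be a $\mathrm{W}$-semigroup. Then: (i) There is an affine homeomorphism $\mathrm{F}_{\mathrm{W}}(S)\cong\mathrm{F}(\gamma(S))$. (ii) If, further, $S$ is a $G$-$\mathrm{W}$-semigroup for a discrete group $G$ and $\pi_G\colon S\to S/G$ is the natural map, then the assignment $\lambda\mapsto\lambda\circ\pi_G$ defines an affine homeomorphism $\mathrm{F}_{\mathrm{W}}(S/G)\cong\mathrm{F}_{\mathrm{W}}^G(S)$. In particular, if $S$ is a $G$-$\mathrm{Cu}$-semigroup, then $\mathrm{F}(\gamma(S/G))\cong\mathrm{F}^G(S)$.
   Context: For a relation $\prec$ on a set, $a^{\prec}=\{b: b\prec a\}$, and $a\leq_\prec b\iff a^\prec\subseteq b^\prec$. A $\mathrm{W}$-semigroup $(S,\prec)$ is an abelian monoid $S$ with a transitive relation $\prec$ such that: $0\prec a$ for all $a$; (W1) for each $a$ there is a sequence $(a_k)$ in $a^\prec$ with $a_k\prec a_{k+1}$ for all $k$ and such that every $b\prec a$ satisfies $b\prec a_k$ for some $k$; (W3) $a'\prec a$ and $b'\prec b$ imply $a'+b'\prec a+b$; (W4) $a\prec b+c$ implies there are $b'\prec b$, $c'\prec c$ with $a\prec b'+c'$. A $G$-$\mathrm{W}$-semigroup is a $\mathrm{W}$-semigroup with a $G$-action by additive maps with $a\prec b\Rightarrow ga\prec gb$. In a partially ordered set, $a\ll b$ means: whenever $(b_n)$ is increasing with a supremum and $b\leq\sup b_n$, then $a\leq b_n$ for some $n$. A $\mathrm{Cu}$-semigroup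 is a positively ordered abelian monoid such that: (O1) increasing sequences have suprema; (O2) every element is the supremum of a sequence $(a_k)$ with $a_k\ll a_{k+1}$; (O3) $a'\ll a$, $b'\ll b$ imply $a'+b'\ll a+b$; (O4) $\sup_k(a_k+b_k)=\sup_ka_k+\sup_kb_k$ for increasing sequences. It is a $\mathrm{W}$-semigroup with $\prec\,=\,\ll$; a $G$-$\mathrm{Cu}$-semigroup is a $\mathrm{Cu}$-semigroup that is a $G$-$\mathrm{W}$-semigroup for $\ll$. Completion: $\gamma(S)$ is the set of $\prec$-increasing sequences $(a_n)$ modulo the antisymmetrization of: $(a_n)\precsim(b_n)$ iff for each $n$ there is $m$ with $a_n\prec b_m$; termwise addition, order induced by $\precsim$. It is a $\mathrm{Cu}$-semigroup. $S/G$: $\leq_G$ is the smallest preorder $\leq$ on $S$ such that any of the following implies $a\leq b$: $a^\prec\subseteq b^\prec$; $a=gb$ for some $g\in G$; $c\leq b$ for all $c\prec a$; $a=a_1+a_2$, $b=b_1+b_2$ with $a_k\leq b_k$ for $k=1,2$. $S/G$ is the antisymmetrization of $(S,\leq_G)$ with induced addition and $[a]\prec[b]\iff$ there is $a'$ with $a\leq_Ga'\prec b$; $\pi_G(a)=[a]$. Functionals: $\mathrm{F}_{\mathrm{W}}(S)$ is the set of additive, zero-preserving, $\leq_\prec$-order-preserving maps $\lambda\colon S\to[0,\infty]$ with $\lambda(a)=\sup_{a'\prec a}\lambda(a')$ for all $a$. $\mathrm{F}_{\mathrm{W}}^G(S)$ is the subset of those with $\lambda(ga)=\lambda(a)$.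 For a $\mathrm{Cu}$-semigroup $S$, $\mathrm{F}(S)$ is the set of additive, zero-preserving, order-preserving maps $S\to[0,\infty]$ that preserve suprema of increasing sequences, and $\mathrm{F}^G(S)$ is the subset of $G$-invariant ones. Topologies: a net $(\lambda_i)$ converges to $\lambda$ iff $\limsup_i\lambda_i(a')\leq\lambda(a)\leq\liminf_i\lambda_i(a)$ for all $a'\prec a$ in $S$ (with $\prec\,=\,\ll$ for $\mathrm{Cu}$-semigroups); the $G$-invariant subsets carry the subspace topology. Affine refers to the pointwise convex (cone) structure. *)

theory Defs
  imports "HOL-Analysis.Analysis" "HOL-Algebra.Group_Action"
begin

text \<open>
  Abelian monoids are the commutative monoids of HOL-Algebra, so the monoid operation \<open>+\<close> of the
  mathematical text is \<open>\<otimes>\<close> and its neutral element \<open>0\<close> is \<open>\<one>\<close>.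
  Relations are only ever considered between elements of the carrier.
\<close>

section \<open>W-semigroups\<close>

record 'a prec_monoid = "'a monoid" +
  prec :: "'a \<Rightarrow> 'a \<Rightarrow> bool" (infixl "\<prec>\<index>" 50)

definition below :: "('a, 'm) prec_monoid_scheme \<Rightarrow> 'a \<Rightarrow> 'a set" where
  "below S a = {b \<in> carrier S. b \<prec>\<^bsub>S\<^esub> a}"

definition below_leq :: "('a, 'm) prec_monoid_scheme \<Rightarrow> 'a \<Rightarrow> 'a \<Rightarrow> bool" where
  "below_leq S a b \<longleftrightarrow> below S a \<subseteq> below S b"

locale W_semigroup = comm_monoid S for S (structure) +
  assumes prec_trans:
      "\<lbrakk>a \<in> carrier S; b \<in> carrier S; c \<in> carrier S; a \<prec>\<^bsub>S\<^esub> b; b \<prec>\<^bsub>S\<^esub> c\<rbrakk> \<Longrightarrow> a \<prec>\<^bsub>S\<^esub> c"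
    and zero_prec: "a \<in> carrier S \<Longrightarrow> \<one> \<prec>\<^bsub>S\<^esub> a"
    and W1: "a \<in> carrier S \<Longrightarrow>
      \<exists>s :: nat \<Rightarrow> _. (\<forall>k. s k \<in> below S a) \<and> (\<forall>k. s k \<prec>\<^bsub>S\<^esub> s (Suc k)) \<and>
        (\<forall>b \<in> below S a. \<exists>k. b \<prec>\<^bsub>S\<^esub> s k)"
    and W3: "\<lbrakk>a \<in> carrier S; b \<in> carrier S; a' \<in> below S a; b' \<in> below S b\<rbrakk> \<Longrightarrow>
      a' \<otimes> b' \<prec>\<^bsub>S\<^esub> a \<otimes> b"
    and W4: "\<lbrakk>b \<in> carrier S; c \<in> carrier S; a \<in> below S (b \<otimes> c)\<rbrakk> \<Longrightarrow>
      \<exists>b' \<in> below S b. \<exists>c' \<in> below S c. a \<prec>\<^bsub>S\<^esub> b' \<otimes> c'"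

locale G_W_semigroup = W_semigroup S + group_action G "carrier S" \<phi>
  for G (structure) and S (structure) and \<phi> +
  assumes act_additive: "\<lbrakk>g \<in> carrier G; a \<in> carrier S; b \<in> carrier S\<rbrakk> \<Longrightarrow>
      \<phi> g (a \<otimes>\<^bsub>S\<^esub> b) = \<phi> g a \<otimes>\<^bsub>S\<^esub> \<phi> g b"
    and act_zero: "g \<in> carrier G \<Longrightarrow> \<phi> g \<one>\<^bsub>S\<^esub> = \<one>\<^bsub>S\<^esub>"
    and act_prec: "\<lbrakk>g \<in> carrier G; a \<in> carrier S; b \<in> carrier S; a \<prec>\<^bsub>S\<^esub> b\<rbrakk> \<Longrightarrow>
      \<phi> g a \<prec>\<^bsub>S\<^esub> \<phi> g b"

section \<open>Cu-semigroups\<close>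

record 'a leq_monoid = "'a monoid" +
  leq :: "'a \<Rightarrow> 'a \<Rightarrow> bool" (infixl "\<preceq>\<index>" 50)

definition poset_of :: "('a, 'm) leq_monoid_scheme \<Rightarrow> 'a gorder" where
  "poset_of T = \<lparr>carrier = carrier T, eq = (=), gorder.le = leq T\<rparr>"

definition incr_seq :: "('a, 'm) leq_monoid_scheme \<Rightarrow> (nat \<Rightarrow> 'a) \<Rightarrow> bool" where
  "incr_seq T s \<longleftrightarrow> (\<forall>n. s n \<in> carrier T \<and> s n \<preceq>\<^bsub>T\<^esub> s (Suc n))"

definition is_sup :: "('a, 'm) leq_monoid_scheme \<Rightarrow> (nat \<Rightarrow> 'a) \<Rightarrow> 'a \<Rightarrow> bool" where
  "is_sup T s x \<longleftrightarrow> least (poset_of T) x (Upper (poset_of T) (range s))"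

definition way_below :: "('a, 'm) leq_monoid_scheme \<Rightarrow> 'a \<Rightarrow> 'a \<Rightarrow> bool" where
  "way_below T a b \<longleftrightarrow>
     (\<forall>s x. incr_seq T s \<and> is_sup T s x \<and> b \<preceq>\<^bsub>T\<^esub> x \<longrightarrow> (\<exists>n. a \<preceq>\<^bsub>T\<^esub> s n))"

locale Cu_semigroup = comm_monoid T for T (structure) +
  assumes poset: "partial_order (poset_of T)"
    and zero_leq: "a \<in> carrier T \<Longrightarrow> \<one> \<preceq>\<^bsub>T\<^esub> a"
    and leq_add: "\<lbrakk>a \<in> carrier T; b \<in> carrier T; c \<in> carrier T; a \<preceq>\<^bsub>T\<^esub> b\<rbrakk> \<Longrightarrow>
      a \<otimes> c \<preceq>\<^bsub>T\<^esub> b \<otimes> c"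
    and O1: "incr_seq T s \<Longrightarrow> \<exists>x. is_sup T s x"
    and O2: "a \<in> carrier T \<Longrightarrow>
      \<exists>s. (\<forall>k. s k \<in> carrier T) \<and> (\<forall>k. way_below T (s k) (s (Suc k))) \<and> is_sup T s a"
    and O3: "\<lbrakk>a \<in> carrier T; a' \<in> carrier T; b \<in> carrier T; b' \<in> carrier T;
      way_below T a' a; way_below T b' b\<rbrakk> \<Longrightarrow> way_below T (a' \<otimes> b') (a \<otimes> b)"
    and O4: "\<lbrakk>incr_seq T s; incr_seq T t; is_sup T s x; is_sup T t y\<rbrakk> \<Longrightarrow>
      is_sup T (\<lambda>k. s k \<otimes> t k) (x \<otimes> y)"

definition way_below_monoid :: "('a, 'm) leq_monoid_scheme \<Rightarrow> 'a prec_monoid" where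
  "way_below_monoid T =
     \<lparr>carrier = carrier T, mult = mult T, one = one T, prec = way_below T\<rparr>"

definition G_Cu_semigroup ::
  "('g, 'n) monoid_scheme \<Rightarrow> ('a, 'm) leq_monoid_scheme \<Rightarrow> ('g \<Rightarrow> 'a \<Rightarrow> 'a) \<Rightarrow> bool" where
  "G_Cu_semigroup G T \<phi> \<longleftrightarrow> Cu_semigroup T \<and> G_W_semigroup G (way_below_monoid T) \<phi>"

section \<open>The completion\<close>

definition prec_seqs :: "('a, 'm) prec_monoid_scheme \<Rightarrow> (nat \<Rightarrow> 'a) set" where
  "prec_seqs S = {s. \<forall>n. s n \<in> carrier S \<and> s n \<prec>\<^bsub>S\<^esub> s (Suc n)}"

definition seq_leq :: "('a, 'm) prec_monoid_scheme \<Rightarrow> (nat \<Rightarrow> 'a) \<Rightarrow> (nat \<Rightarrow> 'a) \<Rightarrow> bool" where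
  "seq_leq S s t \<longleftrightarrow> (\<forall>n. \<exists>m. s n \<prec>\<^bsub>S\<^esub> t m)"

definition seq_equiv :: "('a, 'm) prec_monoid_scheme \<Rightarrow> (nat \<Rightarrow> 'a) rel" where
  "seq_equiv S = {(s, t). s \<in> prec_seqs S \<and> t \<in> prec_seqs S \<and> seq_leq S s t \<and> seq_leq S t s}"

definition Cu_completion :: "('a, 'm) prec_monoid_scheme \<Rightarrow> (nat \<Rightarrow> 'a) set leq_monoid" where
  "Cu_completion S =
     \<lparr>carrier = prec_seqs S // seq_equiv S,
      mult = (\<lambda>A B. \<Union>s \<in> A. \<Union>t \<in> B. seq_equiv S `` {\<lambda>n. s n \<otimes>\<^bsub>S\<^esub> t n}),
      one = seq_equiv S `` {\<lambda>n. \<one>\<^bsub>S\<^esub>},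
      leq = (\<lambda>A B. \<exists>s \<in> A. \<exists>t \<in> B. seq_leq S s t)\<rparr>"

section \<open>The quotient by a group action\<close>

inductive orbit_leq ::
  "('g, 'n) monoid_scheme \<Rightarrow> ('a, 'm) prec_monoid_scheme \<Rightarrow> ('g \<Rightarrow> 'a \<Rightarrow> 'a) \<Rightarrow> 'a \<Rightarrow> 'a \<Rightarrow> bool"
  for G S \<phi> where
  orbit_leq_refl: "a \<in> carrier S \<Longrightarrow> orbit_leq G S \<phi> a a"
| orbit_leq_trans: "orbit_leq G S \<phi> a b \<Longrightarrow> orbit_leq G S \<phi> b c \<Longrightarrow> orbit_leq G S \<phi> a c"
| orbit_leq_below: "a \<in> carrier S \<Longrightarrow> b \<in> carrier S \<Longrightarrow> below S a \<subseteq> below S b \<Longrightarrow> orbit_leq G S \<phi> a b"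
| orbit_leq_orbit: "b \<in> carrier S \<Longrightarrow> g \<in> carrier G \<Longrightarrow> orbit_leq G S \<phi> (\<phi> g b) b"
| orbit_leq_limit: "a \<in> carrier S \<Longrightarrow> b \<in> carrier S \<Longrightarrow> (\<And>c. c \<in> below S a \<Longrightarrow> orbit_leq G S \<phi> c b) \<Longrightarrow>
    orbit_leq G S \<phi> a b"
| orbit_leq_add: "orbit_leq G S \<phi> a1 b1 \<Longrightarrow> orbit_leq G S \<phi> a2 b2 \<Longrightarrow>
    orbit_leq G S \<phi> (a1 \<otimes>\<^bsub>S\<^esub> a2) (b1 \<otimes>\<^bsub>S\<^esub> b2)"

definition orbit_equiv ::
  "('g, 'n) monoid_scheme \<Rightarrow> ('a, 'm) prec_monoid_scheme \<Rightarrow> ('g \<Rightarrow> 'a \<Rightarrow> 'a) \<Rightarrow> 'a rel" where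
  "orbit_equiv G S \<phi> = {(a, b). a \<in> carrier S \<and> b \<in> carrier S \<and>
     orbit_leq G S \<phi> a b \<and> orbit_leq G S \<phi> b a}"

definition quot_map ::
  "('g, 'n) monoid_scheme \<Rightarrow> ('a, 'm) prec_monoid_scheme \<Rightarrow> ('g \<Rightarrow> 'a \<Rightarrow> 'a) \<Rightarrow> 'a \<Rightarrow> 'a set" where
  "quot_map G S \<phi> a = orbit_equiv G S \<phi> `` {a}"

definition quot ::
  "('g, 'n) monoid_scheme \<Rightarrow> ('a, 'm) prec_monoid_scheme \<Rightarrow> ('g \<Rightarrow> 'a \<Rightarrow> 'a) \<Rightarrow> 'a set prec_monoid"
where
  "quot G S \<phi> =
     \<lparr>carrier = carrier S // orbit_equiv G S \<phi>,
      mult = (\<lambda>A B. \<Union>a \<in> A. \<Union>b \<in> B. quot_map G S \<phi> (a \<otimes>\<^bsub>S\<^esub> b)),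
      one = quot_map G S \<phi> \<one>\<^bsub>S\<^esub>,
      prec = (\<lambda>A B. \<exists>a \<in> A. \<exists>b \<in> B. \<exists>a' \<in> below S b. orbit_leq G S \<phi> a a')\<rparr>"

section \<open>Functionals\<close>

text \<open>
  Functionals are represented by their extensional extension (value \<open>undefined\<close> off the carrier),
  so that equality of HOL functions is equality of maps on the carrier.
\<close>

definition additive_maps :: "('a, 'm) monoid_scheme \<Rightarrow> ('a \<Rightarrow> ennreal) set" where
  "additive_maps S = {l \<in> extensional (carrier S). l \<one>\<^bsub>S\<^esub> = 0 \<and>
     (\<forall>a \<in> carrier S. \<forall>b \<in> carrier S. l (a \<otimes>\<^bsub>S\<^esub> b) = l a + l b)}"

definition W_functionals :: "('a, 'm) prec_monoid_scheme \<Rightarrow> ('a \<Rightarrow> ennreal) set" where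
  "W_functionals S = {l \<in> additive_maps S.
     (\<forall>a \<in> carrier S. \<forall>b \<in> carrier S. below_leq S a b \<longrightarrow> l a \<le> l b) \<and>
     (\<forall>a \<in> carrier S. l a = (SUP a' \<in> below S a. l a'))}"

definition Cu_functionals :: "('a, 'm) leq_monoid_scheme \<Rightarrow> ('a \<Rightarrow> ennreal) set" where
  "Cu_functionals T = {l \<in> additive_maps T.
     (\<forall>a \<in> carrier T. \<forall>b \<in> carrier T. a \<preceq>\<^bsub>T\<^esub> b \<longrightarrow> l a \<le> l b) \<and>
     (\<forall>s x. incr_seq T s \<and> is_sup T s x \<longrightarrow> l x = (SUP n. l (s n)))}"

definition invariant_functionals ::
  "('g, 'n) monoid_scheme \<Rightarrow> 'a set \<Rightarrow> ('g \<Rightarrow> 'a \<Rightarrow> 'a) \<Rightarrow> ('a \<Rightarrow> ennreal) set" where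
  "invariant_functionals G C \<phi> = {l. \<forall>g \<in> carrier G. \<forall>a \<in> C. l (\<phi> g a) = l a}"

definition functional_conv ::
  "('a, 'm) prec_monoid_scheme \<Rightarrow> ('i \<Rightarrow> 'a \<Rightarrow> ennreal) \<Rightarrow> ('a \<Rightarrow> ennreal) \<Rightarrow> 'i filter \<Rightarrow> bool" where
  "functional_conv S f l F \<longleftrightarrow> (\<forall>a \<in> carrier S. \<forall>a' \<in> below S a.
     Limsup F (\<lambda>i. f i a') \<le> l a \<and> l a \<le> Liminf F (\<lambda>i. f i a))"

text \<open>
  The topology on a set \<open>X\<close> of functionals in which a set is open iff every net in \<open>X\<close> converging
  to one of its points is eventually in it. Nets are rendered as filters on \<open>X\<close>; the lemma
  \<open>limitin_functional_topology\<close> below confirms that the convergent nets of this topology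
  are exactly the prescribed ones.
\<close>

definition functional_topology ::
  "('a, 'm) prec_monoid_scheme \<Rightarrow> ('a \<Rightarrow> ennreal) set \<Rightarrow> ('a \<Rightarrow> ennreal) topology" where
  "functional_topology S X = topology (\<lambda>U. U \<subseteq> X \<and>
     (\<forall>l \<in> U. \<forall>F. eventually (\<lambda>m. m \<in> X) F \<and> functional_conv S (\<lambda>m. m) l F \<longrightarrow>
        eventually (\<lambda>m. m \<in> U) F))"

definition W_functional_space :: "('a, 'm) prec_monoid_scheme \<Rightarrow> ('a \<Rightarrow> ennreal) topology" where
  "W_functional_space S = functional_topology S (W_functionals S)"

definition Cu_functional_space :: "('a, 'm) leq_monoid_scheme \<Rightarrow> ('a \<Rightarrow> ennreal) topology" where
  "Cu_functional_space T = functional_topology (way_below_monoid T) (Cu_functionals T)"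

lemma openin_functional_topology:
  "openin (functional_topology S X) U \<longleftrightarrow> U \<subseteq> X \<and>
     (\<forall>l \<in> U. \<forall>F. eventually (\<lambda>m. m \<in> X) F \<and> functional_conv S (\<lambda>m. m) l F \<longrightarrow>
        eventually (\<lambda>m. m \<in> U) F)"
proof -
  let ?P = "\<lambda>U. U \<subseteq> X \<and>
     (\<forall>l \<in> U. \<forall>F. eventually (\<lambda>m. m \<in> X) F \<and> functional_conv S (\<lambda>m. m) l F \<longrightarrow>
        eventually (\<lambda>m. m \<in> U) F)"
  have "istopology ?P"
    unfolding istopology_def
  proof (rule conjI; intro allI impI)
    fix U V assume "?P U" "?P V"
    then show "?P (U \<inter> V)"
      by (auto intro: eventually_conj)
  next
    fix \<K> assume K: "\<forall>K \<in> \<K>. ?P K"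
    have "\<Union>\<K> \<subseteq> X"
      using K by blast
    moreover have "\<forall>l \<in> \<Union>\<K>. \<forall>F. eventually (\<lambda>m. m \<in> X) F \<and> functional_conv S (\<lambda>m. m) l F \<longrightarrow>
        eventually (\<lambda>m. m \<in> \<Union>\<K>) F"
    proof (intro ballI allI impI)
      fix l F
      assume "l \<in> \<Union>\<K>" and F: "eventually (\<lambda>m. m \<in> X) F \<and> functional_conv S (\<lambda>m. m) l F"
      then obtain U where U: "U \<in> \<K>" "l \<in> U" by blast
      then have "eventually (\<lambda>m. m \<in> U) F" using K F by blast
      then show "eventually (\<lambda>m. m \<in> \<Union>\<K>) F"
        by (rule eventually_mono) (use U in blast)
    qed
    ultimately show "?P (\<Union>\<K>)" by blast
  qed
  then show ?thesis
    by (simp add: functional_topology_def topology_inverse')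
qed

lemma topspace_functional_topology [simp]: "topspace (functional_topology S X) = X"
proof -
  have "openin (functional_topology S X) X"
    by (simp add: openin_functional_topology)
  moreover have "topspace (functional_topology S X) \<subseteq> X"
    using openin_topspace[of "functional_topology S X"]
    by (simp only: openin_functional_topology)
  ultimately show ?thesis
    using openin_subset by blast
qed

lemma functional_conv_filtermap:
  "functional_conv S (\<lambda>m. m) l (filtermap f F) \<longleftrightarrow> functional_conv S f l F"
  by (simp add: functional_conv_def Limsup_le_iff le_Liminf_iff eventually_filtermap)

lemma (in W_semigroup) limitin_functional_topology:
  assumes mono: "\<And>m a a'. \<lbrakk>m \<in> X; a \<in> carrier S; a' \<in> below S a\<rbrakk> \<Longrightarrow> m a' \<le> m a"
    and f: "eventually (\<lambda>i. f i \<in> X) F" and l: "l \<in> X"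
  shows "limitin (functional_topology S X) f l F \<longleftrightarrow> functional_conv S f l F"
proof
  assume conv: "functional_conv S f l F"
  show "limitin (functional_topology S X) f l F"
    unfolding limitin_def
  proof (intro conjI allI impI)
    show "l \<in> topspace (functional_topology S X)" using l by simp
    fix U assume U: "openin (functional_topology S X) U \<and> l \<in> U"
    have "eventually (\<lambda>m. m \<in> X) (filtermap f F)"
      using f by (simp add: eventually_filtermap)
    then have "eventually (\<lambda>m. m \<in> U) (filtermap f F)"
      using U conv unfolding openin_functional_topology
      by (metis functional_conv_filtermap)
    then show "eventually (\<lambda>i. f i \<in> U) F"
      by (simp add: eventually_filtermap)
  qed
next
  assume lim: "limitin (functional_topology S X) f l F"
  show "functional_conv S f l F"
    unfolding functional_conv_def Limsup_le_iff le_Liminf_iff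
  proof (intro ballI conjI allI impI)
    fix a a' y
    assume a: "a \<in> carrier S" and a': "a' \<in> below S a" and y: "l a < y"
    let ?U = "{m \<in> X. \<exists>b \<in> carrier S. a' \<in> below S b \<and> m b < y}"
    have "openin (functional_topology S X) ?U"
      unfolding openin_functional_topology
    proof (intro conjI ballI allI impI)
      fix m F'
      assume "m \<in> ?U"
        and F': "eventually (\<lambda>m. m \<in> X) F' \<and> functional_conv S (\<lambda>m. m) m F'"
      then obtain b where b: "b \<in> carrier S" "a' \<in> below S b" "m b < y" by blast
      obtain c where c: "c \<in> below S b" "a' \<prec>\<^bsub>S\<^esub> c"
        using W1[OF b(1)] b(2) by blast
      have "Limsup F' (\<lambda>m. m c) \<le> m b"
        using F' b(1) c(1) unfolding functional_conv_def by blast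
      then have "eventually (\<lambda>m. m c < y) F'"
        using b(3) unfolding Limsup_le_iff by blast
      then show "eventually (\<lambda>m. m \<in> ?U) F'"
        using conjunct1[OF F']
        by eventually_elim (use b(2) c in \<open>auto simp: below_def\<close>)
    qed blast
    moreover have "l \<in> ?U" using l a a' y by blast
    ultimately have "eventually (\<lambda>i. f i \<in> ?U) F"
      using lim unfolding limitin_def by blast
    then show "eventually (\<lambda>i. f i a' < y) F"
      by (rule eventually_mono) (use mono in \<open>blast intro: le_less_trans\<close>)
  next
    fix a a' y
    assume a: "a \<in> carrier S" and y: "y < l a"
    let ?U = "{m \<in> X. y < m a}"
    have "openin (functional_topology S X) ?U"
      unfolding openin_functional_topology
    proof (intro conjI ballI allI impI)
      fix m F'
      assume m: "m \<in> ?U"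
        and F': "eventually (\<lambda>m. m \<in> X) F' \<and> functional_conv S (\<lambda>m. m) m F'"
      have "\<one> \<in> below S a" using zero_prec a by (simp add: below_def)
      then have "m a \<le> Liminf F' (\<lambda>m. m a)"
        using F' a unfolding functional_conv_def by blast
      then have "eventually (\<lambda>m. y < m a) F'"
        using m unfolding le_Liminf_iff by blast
      then show "eventually (\<lambda>m. m \<in> ?U) F'"
        using conjunct1[OF F'] by eventually_elim blast
    qed blast
    then have "eventually (\<lambda>i. f i \<in> ?U) F"
      using lim l y unfolding limitin_def by blast
    then show "eventually (\<lambda>i. y < f i a) F"
      by (rule eventually_mono) blast
  qed
qed

corollary (in W_semigroup) limitin_W_functional_space:
  assumes "eventually (\<lambda>i. f i \<in> W_functionals S) F" and "l \<in> W_functionals S"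
  shows "limitin (W_functional_space S) f l F \<longleftrightarrow> functional_conv S f l F"
  unfolding W_functional_space_def
proof (rule limitin_functional_topology[OF _ assms])
  fix m a a' assume "m \<in> W_functionals S" and a: "a \<in> carrier S" and a': "a' \<in> below S a"
  then have "m a = (SUP a' \<in> below S a. m a')"
    unfolding W_functionals_def by blast
  then show "m a' \<le> m a"
    using a' by (metis SUP_upper)
qed

section \<open>Affine homeomorphisms\<close>

definition cone_comb ::
  "'a set \<Rightarrow> real \<Rightarrow> ('a \<Rightarrow> ennreal) \<Rightarrow> real \<Rightarrow> ('a \<Rightarrow> ennreal) \<Rightarrow> 'a \<Rightarrow> ennreal" where
  "cone_comb C r l t m = (\<lambda>a \<in> C. ennreal r * l a + ennreal t * m a)"

text \<open>
  Affinity is required for all combinations with non-negative real coefficients, in particular for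
  convex ones; \<open>C\<close> and \<open>D\<close> are the carriers on which the functionals live.
\<close>

definition affine_homeomorphism ::
  "'a set \<Rightarrow> ('a \<Rightarrow> ennreal) topology \<Rightarrow> 'b set \<Rightarrow> ('b \<Rightarrow> ennreal) topology \<Rightarrow>
   (('a \<Rightarrow> ennreal) \<Rightarrow> ('b \<Rightarrow> ennreal)) \<Rightarrow> bool" where
  "affine_homeomorphism C X D Y h \<longleftrightarrow> homeomorphic_map X Y h \<and>
     (\<forall>l \<in> topspace X. \<forall>m \<in> topspace X. \<forall>r \<ge> 0. \<forall>t \<ge> 0.
        h (cone_comb C r l t m) = cone_comb D r (h l) t (h m))"

end

theory Submission
  imports Defs
begin

text \<open>
  The embedding \<open>a \<mapsto> [(a\<^sub>k)]\<close> of \<open>S\<close> into its completion, with \<open>(a\<^sub>k)\<close> a sequence as in (W1), is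
  additive, turns \<open>\<prec>\<close> into \<open>\<lless>\<close>, and exhibits every class \<open>[(s\<^sub>n)]\<close> as the supremum of the images of
  the \<open>s\<^sub>n\<close>. Hence a functional on the completion is determined by its restriction to \<open>S\<close>, and
  \<open>[(s\<^sub>n)] \<mapsto> sup \<lambda>(s\<^sub>n)\<close> extends every \<open>\<lambda>\<close>; the convergence conditions on both sides match because
  anything way below \<open>[(s\<^sub>n)]\<close> is dominated by the image of some \<open>s\<^sub>n\<close>.

  For the quotient, the key is an interpolation property: if \<open>c \<prec> a \<le>\<^sub>G b\<close>, then \<open>c \<le>\<^sub>G d\<close> for some
  \<open>d \<prec> b\<close>. It makes \<open>S/G\<close> a W-semigroup whose order is that induced by \<open>\<le>\<^sub>G\<close>, while an invariant
  functional is monotone for \<open>\<le>\<^sub>G\<close> by minimality of the latter. On a Cu-semigroup the functionals for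
  \<open>\<lless>\<close> are the Cu-functionals, so the last part is a composition of the first two.
\<close>

section \<open>Spaces of functionals\<close>

lemma functional_conv_cong:
  assumes "eventually (\<lambda>i. \<forall>a \<in> carrier S. f i a = g i a) F"
  shows "functional_conv S f l F \<longleftrightarrow> functional_conv S g l F"
proof -
  have "Limsup F (\<lambda>i. f i a) = Limsup F (\<lambda>i. g i a)"
       "Liminf F (\<lambda>i. f i a) = Liminf F (\<lambda>i. g i a)" if "a \<in> carrier S" for a
    using assms that by (auto intro!: Limsup_eq Liminf_eq elim: eventually_mono)
  then show ?thesis
    unfolding functional_conv_def by (auto simp: below_def)
qed

text \<open>Open sets are defined through convergent filters alone, so a bijection that preserves
  and reflects convergence matches the open sets of both sides. Filters on \<open>X\<close> are
  pushed forward along \<open>h\<close>, filters on \<open>Y\<close> along its inverse.\<close>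

lemma homeomorphic_map_functional_topology:
  assumes bij: "bij_betw h X Y"
    and conv: "\<And>l F. \<lbrakk>l \<in> X; eventually (\<lambda>m. m \<in> X) F\<rbrakk> \<Longrightarrow>
      functional_conv S (\<lambda>m. m) l F \<longleftrightarrow> functional_conv T h (h l) F"
  shows "homeomorphic_map (functional_topology S X) (functional_topology T Y) h"
proof (rule bijective_open_imp_homeomorphic_map)
  show "continuous_map (functional_topology S X) (functional_topology T Y) h"
    unfolding continuous_map_def topspace_functional_topology
  proof (intro conjI allI impI)
    show "h \<in> X \<rightarrow> Y" using bij by (auto simp: bij_betw_def)
    fix V assume V: "openin (functional_topology T Y) V"
    show "openin (functional_topology S X) {x \<in> X. h x \<in> V}"
      unfolding openin_functional_topology
    proof (intro conjI ballI allI impI)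
      fix l F
      assume l: "l \<in> {x \<in> X. h x \<in> V}"
        and F: "eventually (\<lambda>m. m \<in> X) F \<and> functional_conv S (\<lambda>m. m) l F"
      have "functional_conv T (\<lambda>m. m) (h l) (filtermap h F)"
        using F l conv[of l F] by (simp add: functional_conv_filtermap)
      moreover have "eventually (\<lambda>m. m \<in> Y) (filtermap h F)"
        unfolding eventually_filtermap using conjunct1[OF F]
        by eventually_elim (use bij in \<open>auto simp: bij_betw_def\<close>)
      ultimately have "eventually (\<lambda>m. m \<in> V) (filtermap h F)"
        using V l unfolding openin_functional_topology by blast
      then show "eventually (\<lambda>m. m \<in> {x \<in> X. h x \<in> V}) F"
        unfolding eventually_filtermap using conjunct1[OF F] by eventually_elim blast
    qed blast
  qed
  show "open_map (functional_topology S X) (functional_topology T Y) h"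
    unfolding open_map_def
  proof (intro allI impI)
    fix U assume U: "openin (functional_topology S X) U"
    then have "U \<subseteq> X" by (simp add: openin_functional_topology)
    let ?k = "inv_into X h"
    show "openin (functional_topology T Y) (h ` U)"
      unfolding openin_functional_topology
    proof (intro conjI ballI allI impI)
      show "h ` U \<subseteq> Y" using bij \<open>U \<subseteq> X\<close> by (auto simp: bij_betw_def)
      fix l' F
      assume "l' \<in> h ` U"
        and F: "eventually (\<lambda>m. m \<in> Y) F \<and> functional_conv T (\<lambda>m. m) l' F"
      then obtain l where l: "l \<in> U" "l' = h l" by blast
      have hk: "eventually (\<lambda>m. h (?k m) = m \<and> ?k m \<in> X) F"
        using conjunct1[OF F]
        by eventually_elim
          (use bij in \<open>auto simp: bij_betw_def intro: f_inv_into_f inv_into_into\<close>)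
      then have X: "eventually (\<lambda>m. m \<in> X) (filtermap ?k F)"
        unfolding eventually_filtermap by eventually_elim blast
      \<comment> \<open>\<open>h \<circ> ?k\<close> is known to be the identity only on
        \<open>Y\<close>, hence only eventually along \<open>F\<close>, which is enough for upper
        and lower limits.\<close>
      have "functional_conv T (\<lambda>m. h (?k m)) l' F \<longleftrightarrow> functional_conv T (\<lambda>m. m) l' F"
        by (rule functional_conv_cong) (use hk in eventually_elim, simp)
      then have "functional_conv T h (h l) (filtermap ?k F)"
        using F l(2) by (simp add: functional_conv_def Limsup_le_iff le_Liminf_iff eventually_filtermap)
      then have "functional_conv S (\<lambda>m. m) l (filtermap ?k F)"
        using conv[OF _ X] l(1) \<open>U \<subseteq> X\<close> by blast
      then have "eventually (\<lambda>m. m \<in> U) (filtermap ?k F)"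
        using U X l(1) unfolding openin_functional_topology by blast
      then show "eventually (\<lambda>m. m \<in> h ` U) F"
        unfolding eventually_filtermap using hk by eventually_elim force
    qed
  qed
qed (use bij in \<open>auto simp: bij_betw_def\<close>)

text \<open>Passing to \<open>I\<close> restricts the filters to be tested, which gives one
  inclusion. For the other, the neighbourhood filter of a point in the subspace is itself a test
  filter: by \<open>limitin_functional_topology\<close>, where \<open>mono\<close> enters, it
  converges in the prescribed sense, so any \<open>V\<close> open for \<open>X \<inter> I\<close> is
  a neighbourhood of each of its points.\<close>

lemma (in W_semigroup) subtopology_functional_topology:
  assumes mono: "\<And>m a a'. \<lbrakk>m \<in> X; a \<in> carrier S; a' \<in> below S a\<rbrakk> \<Longrightarrow> m a' \<le> m a"
  shows "subtopology (functional_topology S X) I = functional_topology S (X \<inter> I)"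
proof (rule topology_eq[THEN iffD2], intro allI iffI)
  fix V assume "openin (subtopology (functional_topology S X) I) V"
  then obtain U where U: "openin (functional_topology S X) U" "V = U \<inter> I"
    by (auto simp: openin_subtopology)
  show "openin (functional_topology S (X \<inter> I)) V"
    unfolding openin_functional_topology
  proof (intro conjI ballI allI impI)
    show "V \<subseteq> X \<inter> I" using U by (auto simp: openin_functional_topology)
    fix l F
    assume "l \<in> V"
      and F: "eventually (\<lambda>m. m \<in> X \<inter> I) F \<and> functional_conv S (\<lambda>m. m) l F"
    have "eventually (\<lambda>m. m \<in> X) F"
      using conjunct1[OF F] by eventually_elim blast
    then have "eventually (\<lambda>m. m \<in> U) F"
      using U F \<open>l \<in> V\<close> unfolding openin_functional_topology by blast
    then show "eventually (\<lambda>m. m \<in> V) F"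
      using conjunct1[OF F] by eventually_elim (use U in blast)
  qed
next
  fix V assume V: "openin (functional_topology S (X \<inter> I)) V"
  let ?Y = "subtopology (functional_topology S X) I"
  have "\<exists>W. openin ?Y W \<and> l \<in> W \<and> W \<subseteq> V" if "l \<in> V" for l
  proof -
    have l: "l \<in> X" "l \<in> I" using V that by (auto simp: openin_functional_topology)
    let ?F = "nhdsin ?Y l"
    have ev: "eventually (\<lambda>m. m \<in> X \<inter> I) ?F"
      unfolding eventually_nhdsin
      using l openin_topspace[of ?Y] by (auto simp del: openin_topspace)
    then have X: "eventually (\<lambda>m. m \<in> X) ?F" by eventually_elim blast
    have "limitin (functional_topology S X) (\<lambda>m. m) l ?F"
      unfolding limitin_def
    proof (intro conjI allI impI)
      show "l \<in> topspace (functional_topology S X)" using l by simp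
      fix U assume U: "openin (functional_topology S X) U \<and> l \<in> U"
      then have "openin ?Y (U \<inter> I)" by (auto simp: openin_subtopology)
      then show "eventually (\<lambda>m. m \<in> U) ?F"
        unfolding eventually_nhdsin using U l by blast
    qed
    then have "functional_conv S (\<lambda>m. m) l ?F"
      using limitin_functional_topology[OF mono X l(1)] by blast
    then have "eventually (\<lambda>m. m \<in> V) ?F"
      using V ev that unfolding openin_functional_topology by blast
    then show ?thesis
      unfolding eventually_nhdsin using l by auto
  qed
  then show "openin ?Y V"
    by (subst openin_subopen) blast
qed

section \<open>Affine homeomorphisms: inversion and composition\<close>

lemma affine_homeomorphismD:
  assumes "affine_homeomorphism C X D Y h"
  shows "homeomorphic_map X Y h" "l \<in> topspace X \<Longrightarrow> h l \<in> topspace Y"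
    and "\<lbrakk>l \<in> topspace X; m \<in> topspace X; r \<ge> 0; t \<ge> 0\<rbrakk> \<Longrightarrow>
      h (cone_comb C r l t m) = cone_comb D r (h l) t (h m)"
proof -
  show h: "homeomorphic_map X Y h"
    using assms by (simp add: affine_homeomorphism_def)
  show "l \<in> topspace X \<Longrightarrow> h l \<in> topspace Y"
    using imageI[of l "topspace X" h] by (simp add: homeomorphic_imp_surjective_map[OF h])
  show "\<lbrakk>l \<in> topspace X; m \<in> topspace X; r \<ge> 0; t \<ge> 0\<rbrakk> \<Longrightarrow>
      h (cone_comb C r l t m) = cone_comb D r (h l) t (h m)"
    using assms by (simp add: affine_homeomorphism_def)
qed

text \<open>Affinity of \<open>k\<close> results from applying \<open>k\<close> to the affinity of
  \<open>h\<close> at the preimages. The identity \<open>k (h x) = x\<close> is available for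
  \<open>x\<close> in the space, hence the requirement that cone combinations stay in it.\<close>

lemma affine_homeomorphism_inverse:
  assumes h: "affine_homeomorphism C X D Y h"
    and closed: "\<And>l m r t. \<lbrakk>l \<in> topspace X; m \<in> topspace X; r \<ge> 0; t \<ge> 0\<rbrakk> \<Longrightarrow>
      cone_comb C r l t m \<in> topspace X"
  shows "\<exists>k. affine_homeomorphism D Y C X k"
proof -
  obtain k where "homeomorphic_maps X Y h k"
    using affine_homeomorphismD(1)[OF h] by (auto simp: homeomorphic_map_maps)
  then have k: "homeomorphic_map Y X k" and kh: "\<And>x. x \<in> topspace X \<Longrightarrow> k (h x) = x"
    and hk: "\<And>y. y \<in> topspace Y \<Longrightarrow> h (k y) = y"
    by (simp_all add: homeomorphic_maps_map)
  have kX: "k y \<in> topspace X" if "y \<in> topspace Y" for y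
    using imageI[OF that, of k] by (simp add: homeomorphic_imp_surjective_map[OF k])
  have "k (cone_comb D r l t m) = cone_comb C r (k l) t (k m)"
    if lm: "l \<in> topspace Y" "m \<in> topspace Y" and rt: "r \<ge> 0" "t \<ge> 0" for l m r t
  proof -
    have "h (cone_comb C r (k l) t (k m)) = cone_comb D r l t m"
      using affine_homeomorphismD(3)[OF h kX[OF lm(1)] kX[OF lm(2)] rt] hk lm by simp
    then show ?thesis
      using kh[OF closed[OF kX[OF lm(1)] kX[OF lm(2)] rt]] by simp
  qed
  then have "affine_homeomorphism D Y C X k"
    using k by (simp add: affine_homeomorphism_def)
  then show ?thesis by (rule exI[of _ k])
qed

lemma affine_homeomorphism_compose:
  assumes h: "affine_homeomorphism C X D Y h" and k: "affine_homeomorphism D Y E Z k"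
  shows "affine_homeomorphism C X E Z (k \<circ> h)"
  unfolding affine_homeomorphism_def
proof (intro conjI ballI allI impI)
  show "homeomorphic_map X Z (k \<circ> h)"
    by (rule homeomorphic_map_compose[OF affine_homeomorphismD(1)[OF h] affine_homeomorphismD(1)[OF k]])
  show "(k \<circ> h) (cone_comb C r l t m) = cone_comb E r ((k \<circ> h) l) t ((k \<circ> h) m)"
    if "l \<in> topspace X" "m \<in> topspace X" "0 \<le> r" "0 \<le> t" for l m r t
    using affine_homeomorphismD(3)[OF h that] affine_homeomorphismD(3)[OF k _ _ that(3,4)]
      affine_homeomorphismD(2)[OF h] that(1,2) by simp
qed

lemma compose_cone_comb:
  assumes "\<And>a. a \<in> C \<Longrightarrow> p a \<in> D"
  shows "compose C (cone_comb D r l t m) p = cone_comb C r (compose C l p) t (compose C m p)"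
  using assms by (auto simp: compose_def cone_comb_def)

section \<open>Suprema of sequences and elementary properties of functionals\<close>

text \<open>The guards \<open>s n \<in> carrier T\<close> come from \<open>Upper\<close>, which
  bounds only those members of a set that lie in the carrier.\<close>

lemma is_sup_iff:
  "is_sup T s x \<longleftrightarrow> x \<in> carrier T \<and> (\<forall>n. s n \<in> carrier T \<longrightarrow> s n \<preceq>\<^bsub>T\<^esub> x) \<and>
     (\<forall>y \<in> carrier T. (\<forall>n. s n \<in> carrier T \<longrightarrow> s n \<preceq>\<^bsub>T\<^esub> y) \<longrightarrow> x \<preceq>\<^bsub>T\<^esub> y)"
  by (auto simp: is_sup_def least_def Upper_def poset_of_def)

lemma is_sup_least:
  "\<lbrakk>is_sup T s x; y \<in> carrier T; \<And>n. s n \<preceq>\<^bsub>T\<^esub> y\<rbrakk> \<Longrightarrow> x \<preceq>\<^bsub>T\<^esub> y"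
  by (simp add: is_sup_iff)

lemma W_functionals_mono:
  assumes "l \<in> W_functionals S" "a \<in> carrier S" "a' \<in> below S a"
  shows "l a' \<le> l a"
proof -
  have "l a = (SUP a' \<in> below S a. l a')"
    using assms unfolding W_functionals_def by blast
  then show ?thesis
    using assms(3) by (metis SUP_upper)
qed

lemma W_functionals_additive: "l \<in> W_functionals S \<Longrightarrow> l \<in> additive_maps S"
  by (simp add: W_functionals_def)

lemma Cu_functionalsD:
  assumes "l \<in> Cu_functionals T"
  shows "l \<in> additive_maps T"
    and "\<lbrakk>a \<in> carrier T; b \<in> carrier T; a \<preceq>\<^bsub>T\<^esub> b\<rbrakk> \<Longrightarrow> l a \<le> l b"
    and "\<lbrakk>incr_seq T s; is_sup T s x\<rbrakk> \<Longrightarrow> l x = (SUP n. l (s n))"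
  using assms unfolding Cu_functionals_def by blast+

lemma Cu_functionals_incseq:
  assumes "l \<in> Cu_functionals T" "incr_seq T s"
  shows "incseq (\<lambda>n. l (s n))"
  using assms(2) by (auto intro!: incseq_SucI Cu_functionalsD(2)[OF assms(1)] simp: incr_seq_def)

text \<open>In \<open>ennreal\<close>, suprema of increasing sequences commute with sums and with
  multiplication by constants. This supplies the closure hypothesis of
  \<open>affine_homeomorphism_inverse\<close>.\<close>

lemma Cu_functionals_cone_comb:
  assumes T: "\<one>\<^bsub>T\<^esub> \<in> carrier T"
      "\<And>a b. \<lbrakk>a \<in> carrier T; b \<in> carrier T\<rbrakk> \<Longrightarrow> a \<otimes>\<^bsub>T\<^esub> b \<in> carrier T"
    and l: "l \<in> Cu_functionals T" and m: "m \<in> Cu_functionals T"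
  shows "cone_comb (carrier T) r l t m \<in> Cu_functionals T"
  unfolding Cu_functionals_def
proof (intro CollectI conjI ballI allI impI)
  show "cone_comb (carrier T) r l t m \<in> additive_maps T"
    using T Cu_functionalsD(1)[OF l] Cu_functionalsD(1)[OF m]
    by (simp add: additive_maps_def cone_comb_def algebra_simps)
next
  fix a b assume "a \<in> carrier T" "b \<in> carrier T" "a \<preceq>\<^bsub>T\<^esub> b"
  then show "cone_comb (carrier T) r l t m a \<le> cone_comb (carrier T) r l t m b"
    using Cu_functionalsD(2)[OF l] Cu_functionalsD(2)[OF m]
    by (simp add: cone_comb_def add_mono mult_left_mono)
next
  fix s x assume s: "incr_seq T s \<and> is_sup T s x"
  then have mem: "x \<in> carrier T" "\<And>n. s n \<in> carrier T"
    by (auto simp: is_sup_iff incr_seq_def)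
  have "incseq (\<lambda>n. ennreal r * l (s n))" "incseq (\<lambda>n. ennreal t * m (s n))"
    using Cu_functionals_incseq[OF l] Cu_functionals_incseq[OF m] s
    by (auto simp: incseq_def intro!: mult_left_mono)
  moreover have "l x = (SUP n. l (s n))" "m x = (SUP n. m (s n))"
    using Cu_functionalsD(3)[OF l] Cu_functionalsD(3)[OF m] s by blast+
  ultimately show "cone_comb (carrier T) r l t m x = (SUP n. cone_comb (carrier T) r l t m (s n))"
    using mem by (simp add: cone_comb_def ennreal_SUP_add SUP_mult_left_ennreal)
qed

section \<open>Functionals on the completion\<close>

context W_semigroup
begin

section \<open>Increasing sequences and their comparison\<close>

lemma prec_seqs_closed: "s \<in> prec_seqs S \<Longrightarrow> s n \<in> carrier S"
  by (simp add: prec_seqs_def)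

lemma prec_seqs_prec:
  assumes s: "s \<in> prec_seqs S" and "n < m"
  shows "s n \<prec>\<^bsub>S\<^esub> s m"
  using \<open>n < m\<close>
proof (induction m)
  case (Suc m)
  then show ?case
    using s prec_trans[of "s n" "s m" "s (Suc m)"] by (auto simp: prec_seqs_def less_Suc_eq)
qed simp

text \<open>A relation to one term persists at all later terms by transitivity, so finitely many
  such relations can be met at a common index.\<close>

lemma prec_seqs_eventually:
  assumes s: "s \<in> prec_seqs S" and a: "a \<in> carrier S" "a \<prec>\<^bsub>S\<^esub> s n"
  shows "eventually (\<lambda>m. a \<prec>\<^bsub>S\<^esub> s m) sequentially"
proof (rule eventually_sequentiallyI)
  fix m assume "n \<le> m"
  then show "a \<prec>\<^bsub>S\<^esub> s m"
    using prec_trans[OF a(1) _ _ a(2)] prec_seqs_prec[OF s, of n m] prec_seqs_closed[OF s] a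
    by (cases "n = m") auto
qed

lemma seq_leq_refl: "s \<in> prec_seqs S \<Longrightarrow> seq_leq S s s"
  by (auto simp: seq_leq_def prec_seqs_def)

lemma seq_leq_trans:
  assumes "s \<in> prec_seqs S" "t \<in> prec_seqs S" "u \<in> prec_seqs S" "seq_leq S s t" "seq_leq S t u"
  shows "seq_leq S s u"
  using assms unfolding seq_leq_def by (meson prec_trans prec_seqs_closed)

lemma seq_leq_add:
  assumes mem: "s \<in> prec_seqs S" "t \<in> prec_seqs S" "s' \<in> prec_seqs S" "t' \<in> prec_seqs S"
    and le: "seq_leq S s s'" "seq_leq S t t'"
  shows "seq_leq S (\<lambda>n. s n \<otimes> t n) (\<lambda>n. s' n \<otimes> t' n)"
  unfolding seq_leq_def
proof
  fix n
  obtain i j where "s n \<prec>\<^bsub>S\<^esub> s' i" "t n \<prec>\<^bsub>S\<^esub> t' j"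
    using le unfolding seq_leq_def by blast
  then have "eventually (\<lambda>m. s n \<prec>\<^bsub>S\<^esub> s' m \<and> t n \<prec>\<^bsub>S\<^esub> t' m) sequentially"
    using mem by (auto intro!: eventually_conj prec_seqs_eventually prec_seqs_closed)
  then obtain m where "s n \<prec>\<^bsub>S\<^esub> s' m" "t n \<prec>\<^bsub>S\<^esub> t' m"
    using eventually_happens' sequentially_bot by blast
  then show "\<exists>m. s n \<otimes> t n \<prec>\<^bsub>S\<^esub> s' m \<otimes> t' m"
    using mem by (auto intro!: exI[of _ m] W3 simp: below_def prec_seqs_closed)
qed

lemma prec_seqs_add:
  "\<lbrakk>s \<in> prec_seqs S; t \<in> prec_seqs S\<rbrakk> \<Longrightarrow> (\<lambda>n. s n \<otimes> t n) \<in> prec_seqs S"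
  by (auto simp: prec_seqs_def below_def intro!: W3)

lemma prec_seqs_one: "(\<lambda>n. \<one>) \<in> prec_seqs S"
  by (auto simp: prec_seqs_def zero_prec)

section \<open>The completion as a quotient: order, addition, suprema and way-below\<close>

lemma equiv_seq_equiv: "equiv (prec_seqs S) (seq_equiv S)"
  by (rule equivI) (auto simp: refl_on_def sym_def trans_def seq_equiv_def
      intro: seq_leq_refl seq_leq_trans)

abbreviation seq_class :: "(nat \<Rightarrow> 'a) \<Rightarrow> (nat \<Rightarrow> 'a) set" where
  "seq_class s \<equiv> seq_equiv S `` {s}"

lemma seq_class_closed: "s \<in> prec_seqs S \<Longrightarrow> seq_class s \<in> carrier (Cu_completion S)"
  by (simp add: Cu_completion_def quotientI)

lemma carrier_completionE:
  assumes "x \<in> carrier (Cu_completion S)"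
  obtains s where "s \<in> prec_seqs S" "x = seq_class s"
  using assms by (auto simp: Cu_completion_def elim: quotientE)

lemma seq_class_eq_iff:
  "\<lbrakk>s \<in> prec_seqs S; t \<in> prec_seqs S\<rbrakk> \<Longrightarrow>
    seq_class s = seq_class t \<longleftrightarrow> seq_leq S s t \<and> seq_leq S t s"
  using eq_equiv_class_iff[OF equiv_seq_equiv] by (auto simp: seq_equiv_def)

text \<open>The order of the completion asks for some pair of comparable representatives;
  transitivity of \<open>seq_leq\<close> makes the choice irrelevant.\<close>

lemma completion_leq_iff:
  assumes "s \<in> prec_seqs S" "t \<in> prec_seqs S"
  shows "seq_class s \<preceq>\<^bsub>Cu_completion S\<^esub> seq_class t \<longleftrightarrow> seq_leq S s t"
proof
  assume "seq_class s \<preceq>\<^bsub>Cu_completion S\<^esub> seq_class t"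
  then obtain s' t' where "(s, s') \<in> seq_equiv S" "(t, t') \<in> seq_equiv S" "seq_leq S s' t'"
    by (auto simp: Cu_completion_def)
  then show "seq_leq S s t"
    unfolding seq_equiv_def using seq_leq_trans by blast
next
  assume "seq_leq S s t"
  then show "seq_class s \<preceq>\<^bsub>Cu_completion S\<^esub> seq_class t"
    using assms by (auto simp: Cu_completion_def seq_equiv_def intro: seq_leq_refl)
qed

lemma completion_add:
  assumes "s \<in> prec_seqs S" "t \<in> prec_seqs S"
  shows "seq_class s \<otimes>\<^bsub>Cu_completion S\<^esub> seq_class t = seq_class (\<lambda>n. s n \<otimes> t n)"
proof -
  have "congruent2 (seq_equiv S) (seq_equiv S) (\<lambda>s t. seq_class (\<lambda>n. s n \<otimes> t n))"
  proof (rule congruent2I')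
    fix s s' t t' assume "(s, s') \<in> seq_equiv S" "(t, t') \<in> seq_equiv S"
    then show "seq_class (\<lambda>n. s n \<otimes> t n) = seq_class (\<lambda>n. s' n \<otimes> t' n)"
      by (subst seq_class_eq_iff) (auto simp: seq_equiv_def intro!: seq_leq_add prec_seqs_add)
  qed
  then show ?thesis
    using UN_equiv_class2[OF equiv_seq_equiv equiv_seq_equiv] assms
    by (simp add: Cu_completion_def)
qed

lemma completion_one: "\<one>\<^bsub>Cu_completion S\<^esub> = seq_class (\<lambda>n. \<one>)"
  by (simp add: Cu_completion_def)

lemma incr_seq_completion_lift:
  assumes "incr_seq (Cu_completion S) z"
  shows "\<exists>u. (\<forall>k. u k \<in> prec_seqs S) \<and> (\<forall>k. z k = seq_class (u k)) \<and>
    (\<forall>i j. i \<le> j \<longrightarrow> seq_leq S (u i) (u j))"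
proof -
  have "\<forall>k. \<exists>s. s \<in> prec_seqs S \<and> z k = seq_class s"
    using assms carrier_completionE unfolding incr_seq_def by metis
  then obtain u where u: "\<And>k. u k \<in> prec_seqs S" "\<And>k. z k = seq_class (u k)"
    by metis
  have "seq_leq S (u i) (u j)" if "i \<le> j" for i j
    using that
  proof (induction rule: dec_induct)
    case (step n)
    have "seq_leq S (u n) (u (Suc n))"
      using assms u completion_leq_iff by (metis incr_seq_def)
    then show ?case using step.IH u seq_leq_trans by blast
  qed (use u seq_leq_refl in blast)
  with u show ?thesis by blast
qed

text \<open>A representative of the supremum of an increasing sequence of classes:
  \<open>v n = u n (j n)\<close>, with \<open>j n\<close> so large that this term dominates
  \<open>u i k\<close> for all \<open>i\<close>, \<open>k\<close> up to \<open>n\<close>. Then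
  \<open>v\<close> bounds every \<open>u k\<close>, while each of its terms is below an entry of
  some \<open>u k\<close>, so \<open>v\<close> lies below every other upper bound.\<close>

lemma diagonal_seq:
  fixes u :: "nat \<Rightarrow> nat \<Rightarrow> 'a"
  assumes u: "\<And>k. u k \<in> prec_seqs S" and le: "\<And>i j. i \<le> j \<Longrightarrow> seq_leq S (u i) (u j)"
  shows "\<exists>v \<in> prec_seqs S. (\<forall>k. seq_leq S (u k) v) \<and> (\<forall>n. \<exists>k j. v n \<prec>\<^bsub>S\<^esub> u k j)"
proof -
  have ev: "eventually (\<lambda>m. u i k \<prec>\<^bsub>S\<^esub> u j m) sequentially" if "i \<le> j" for i j k :: nat
  proof -
    obtain m where "u i k \<prec>\<^bsub>S\<^esub> u j m" using le[OF \<open>i \<le> j\<close>] unfolding seq_leq_def by blast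
    with u show ?thesis by (intro prec_seqs_eventually prec_seqs_closed)
  qed
  then have all: "eventually (\<lambda>m. \<forall>i \<in> {..n}. \<forall>k \<in> {..n}. u i k \<prec>\<^bsub>S\<^esub> u n m) sequentially" for n
    by (intro eventually_ball_finite ballI) auto
  \<comment> \<open>The indices are chosen one after another: the first condition secures domination
    of a square of entries, the second makes the diagonal itself
    \<open>\<prec>\<close>-increasing.\<close>
  have "\<exists>j. \<forall>n. (\<forall>i \<in> {..n}. \<forall>k \<in> {..n}. u i k \<prec>\<^bsub>S\<^esub> u n (j n)) \<and> u n (j n) \<prec>\<^bsub>S\<^esub> u (Suc n) (j (Suc n))"
  proof (rule dependent_nat_choice)
    show "\<exists>m. \<forall>i \<in> {..0}. \<forall>k \<in> {..0}. u i k \<prec>\<^bsub>S\<^esub> u 0 m"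
      using eventually_happens'[OF sequentially_bot all] .
    fix m n
    show "\<exists>m'. (\<forall>i \<in> {..Suc n}. \<forall>k \<in> {..Suc n}. u i k \<prec>\<^bsub>S\<^esub> u (Suc n) m') \<and> u n m \<prec>\<^bsub>S\<^esub> u (Suc n) m'"
      using eventually_happens'[OF sequentially_bot eventually_conj[OF all ev]] by simp
  qed
  then obtain j where j: "\<And>n i k. \<lbrakk>i \<le> n; k \<le> n\<rbrakk> \<Longrightarrow> u i k \<prec>\<^bsub>S\<^esub> u n (j n)"
    "\<And>n. u n (j n) \<prec>\<^bsub>S\<^esub> u (Suc n) (j (Suc n))" by auto
  show ?thesis
  proof (intro bexI[of _ "\<lambda>n. u n (j n)"] conjI allI)
    show "(\<lambda>n. u n (j n)) \<in> prec_seqs S"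
      using j(2) u by (simp add: prec_seqs_def)
    show "seq_leq S (u k) (\<lambda>n. u n (j n))" for k
      unfolding seq_leq_def
    proof
      show "\<exists>m. u k n \<prec>\<^bsub>S\<^esub> u m (j m)" for n
        \<comment> \<open>The entry \<open>u k n\<close> lies in the square belonging to the index
          \<open>max k n\<close>.\<close>
        using j(1)[of k "max k n" n] by auto
    qed
    show "\<exists>k i. u n (j n) \<prec>\<^bsub>S\<^esub> u k i" for n
      using j(2) by blast
  qed
qed

text \<open>If the class of \<open>t\<close> lies below the supremum of \<open>z\<close>, then the
  single term \<open>t m\<close> lies below a diagonal term and so below one entry
  \<open>u k j\<close>. As \<open>t m\<close> dominates all of \<open>s\<close>, the same
  \<open>k\<close> serves every \<open>s n\<close>, and the class of \<open>s\<close> lies below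
  \<open>z k\<close>.\<close>

lemma way_below_completionI:
  assumes s: "s \<in> prec_seqs S" and t: "t \<in> prec_seqs S" and st: "\<And>n. s n \<prec>\<^bsub>S\<^esub> t m"
  shows "way_below (Cu_completion S) (seq_class s) (seq_class t)"
  unfolding way_below_def
proof (intro allI impI)
  let ?T = "Cu_completion S"
  fix z x assume z: "incr_seq ?T z \<and> is_sup ?T z x \<and> seq_class t \<preceq>\<^bsub>?T\<^esub> x"
  then obtain u where u: "\<And>k. u k \<in> prec_seqs S" "\<And>k. z k = seq_class (u k)"
    "\<And>i j. i \<le> j \<Longrightarrow> seq_leq S (u i) (u j)"
    using incr_seq_completion_lift[OF conjunct1[OF z]] by auto
  obtain v where v: "v \<in> prec_seqs S" "\<And>k. seq_leq S (u k) v" "\<And>n. \<exists>k j. v n \<prec>\<^bsub>S\<^esub> u k j"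
    using diagonal_seq[of u, OF u(1) u(3)] by auto
  have "x \<in> carrier ?T" using z by (simp add: is_sup_iff)
  then obtain w where w: "w \<in> prec_seqs S" "x = seq_class w" by (rule carrier_completionE)
  have "x \<preceq>\<^bsub>?T\<^esub> seq_class v"
    by (rule is_sup_least[of ?T z x])
      (use z in \<open>simp_all add: u(2) seq_class_closed[OF v(1)] completion_leq_iff[OF u(1) v(1)] v(2)\<close>)
  then have "seq_leq S t v"
    using z seq_leq_trans[OF t w(1) v(1)]
    by (simp add: w(2) completion_leq_iff[OF t w(1)] completion_leq_iff[OF w(1) v(1)])
  then obtain n' where "t m \<prec>\<^bsub>S\<^esub> v n'" unfolding seq_leq_def by blast
  moreover obtain k j where "v n' \<prec>\<^bsub>S\<^esub> u k j" using v(3) by blast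
  ultimately have "s n \<prec>\<^bsub>S\<^esub> u k j" for n
    using st[of n] prec_trans[of "s n" "t m" "u k j"] prec_trans[of "t m" "v n'" "u k j"]
      prec_seqs_closed[OF s] prec_seqs_closed[OF t] prec_seqs_closed[OF u(1)] prec_seqs_closed[OF v(1)]
    by blast
  then show "\<exists>n. seq_class s \<preceq>\<^bsub>?T\<^esub> z n"
    using completion_leq_iff[OF s u(1)] u(2) unfolding seq_leq_def by metis
qed

section \<open>The embedding of the semigroup into its completion\<close>

definition approx :: "'a \<Rightarrow> nat \<Rightarrow> 'a" where
  "approx a = (SOME s. (\<forall>k. s k \<in> below S a) \<and> (\<forall>k. s k \<prec>\<^bsub>S\<^esub> s (Suc k)) \<and>
     (\<forall>b \<in> below S a. \<exists>k. b \<prec>\<^bsub>S\<^esub> s k))"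

lemma approx:
  assumes "a \<in> carrier S"
  shows "approx a k \<in> below S a" "approx a \<in> prec_seqs S"
    "b \<in> below S a \<Longrightarrow> \<exists>k. b \<prec>\<^bsub>S\<^esub> approx a k"
proof -
  have *: "(\<forall>k. approx a k \<in> below S a) \<and> (\<forall>k. approx a k \<prec>\<^bsub>S\<^esub> approx a (Suc k)) \<and>
     (\<forall>b \<in> below S a. \<exists>k. b \<prec>\<^bsub>S\<^esub> approx a k)"
    using someI_ex[OF W1[OF assms]] unfolding approx_def .
  then show "approx a k \<in> below S a" "b \<in> below S a \<Longrightarrow> \<exists>k. b \<prec>\<^bsub>S\<^esub> approx a k" by auto
  show "approx a \<in> prec_seqs S" using * by (auto simp: prec_seqs_def below_def)
qed

text \<open>The class does not depend on the choice made in \<open>approx\<close>: any two sequences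
  as in (W1) for the same element are comparable both ways under \<open>seq_leq\<close>.\<close>

definition embed :: "'a \<Rightarrow> (nat \<Rightarrow> 'a) set" where
  "embed a = seq_class (approx a)"

lemma embed_closed: "a \<in> carrier S \<Longrightarrow> embed a \<in> carrier (Cu_completion S)"
  by (simp add: embed_def seq_class_closed approx)

lemma embed_one: "embed \<one> = \<one>\<^bsub>Cu_completion S\<^esub>"
  unfolding embed_def completion_one
  using approx[OF one_closed] prec_seqs_one zero_prec
  by (subst seq_class_eq_iff) (auto simp: seq_leq_def below_def)

text \<open>(W4) puts every term of \<open>approx (a \<otimes> b)\<close> under a sum of elements
  below \<open>a\<close> and \<open>b\<close>, and by (W3) sums of approximants stay below
  \<open>a \<otimes> b\<close>; the two comparisons give equality of classes.\<close>

lemma embed_add: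
  assumes a: "a \<in> carrier S" and b: "b \<in> carrier S"
  shows "embed (a \<otimes> b) = embed a \<otimes>\<^bsub>Cu_completion S\<^esub> embed b"
proof -
  have ab: "a \<otimes> b \<in> carrier S" using a b by simp
  note a' = approx[OF a] and b' = approx[OF b] and ab' = approx[OF ab]
  have "seq_leq S (approx (a \<otimes> b)) (\<lambda>n. approx a n \<otimes> approx b n)"
    unfolding seq_leq_def
  proof
    fix n
    obtain c d where c: "c \<in> below S a" and d: "d \<in> below S b" and n: "approx (a \<otimes> b) n \<prec>\<^bsub>S\<^esub> c \<otimes> d"
      using W4[OF a b ab'(1)] by blast
    obtain i j where "c \<prec>\<^bsub>S\<^esub> approx a i" "d \<prec>\<^bsub>S\<^esub> approx b j"
      using a'(3)[OF c] b'(3)[OF d] by blast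
    then have "eventually (\<lambda>m. c \<prec>\<^bsub>S\<^esub> approx a m \<and> d \<prec>\<^bsub>S\<^esub> approx b m) sequentially"
      using a'(2) b'(2) c d
      by (auto intro!: eventually_conj intro: prec_seqs_eventually simp: below_def)
    then obtain m where "c \<prec>\<^bsub>S\<^esub> approx a m" "d \<prec>\<^bsub>S\<^esub> approx b m"
      using eventually_happens' sequentially_bot by blast
    then have "c \<otimes> d \<prec>\<^bsub>S\<^esub> approx a m \<otimes> approx b m"
      using a'(1)[of m] b'(1)[of m] c d by (auto intro!: W3 simp: below_def)
    then show "\<exists>m. approx (a \<otimes> b) n \<prec>\<^bsub>S\<^esub> approx a m \<otimes> approx b m"
      using n prec_trans[of "approx (a \<otimes> b) n" "c \<otimes> d" "approx a m \<otimes> approx b m"]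
        a'(1) b'(1) ab'(1) c d by (auto simp: below_def)
  qed
  moreover have "seq_leq S (\<lambda>n. approx a n \<otimes> approx b n) (approx (a \<otimes> b))"
    unfolding seq_leq_def
  proof
    fix n
    have "approx a n \<otimes> approx b n \<in> below S (a \<otimes> b)"
      using W3[OF a b a'(1) b'(1)] a'(1) b'(1) by (auto simp: below_def)
    then show "\<exists>m. approx a n \<otimes> approx b n \<prec>\<^bsub>S\<^esub> approx (a \<otimes> b) m" by (rule ab'(3))
  qed
  ultimately show ?thesis
    using a' b' ab' unfolding embed_def
    by (simp add: completion_add seq_class_eq_iff prec_seqs_add)
qed

lemma embed_leq:
  assumes "a \<in> carrier S" "b \<in> carrier S" "below_leq S a b"
  shows "embed a \<preceq>\<^bsub>Cu_completion S\<^esub> embed b"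
  unfolding embed_def completion_leq_iff[OF approx(2)[OF assms(1)] approx(2)[OF assms(2)]] seq_leq_def
  using approx(1)[OF assms(1)] approx(3)[OF assms(2)] assms(3) unfolding below_leq_def by blast

lemma below_leq_of_below: "\<lbrakk>a \<in> carrier S; b \<in> below S a\<rbrakk> \<Longrightarrow> below_leq S b a"
  by (auto simp: below_leq_def below_def intro: prec_trans)

text \<open>Since \<open>b\<close> lies below a single term of \<open>approx a\<close>, so do all
  terms of \<open>approx b\<close>, which is the situation of
  \<open>way_below_completionI\<close>.\<close>

lemma embed_way_below:
  assumes a: "a \<in> carrier S" and b: "b \<in> below S a"
  shows "way_below (Cu_completion S) (embed b) (embed a)"
proof -
  obtain m where m: "b \<prec>\<^bsub>S\<^esub> approx a m" using approx(3)[OF a b] by blast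
  have bS: "b \<in> carrier S" using b by (simp add: below_def)
  have "approx b n \<prec>\<^bsub>S\<^esub> approx a m" for n
    using m prec_trans[of "approx b n" b "approx a m"] approx(1)[OF bS, of n] approx(1)[OF a, of m] bS
    by (auto simp: below_def)
  then show ?thesis
    unfolding embed_def using approx(2) a bS way_below_completionI by blast
qed

text \<open>This is what makes a functional on the completion determined by its values on the image
  of \<open>embed\<close>.\<close>

lemma embed_sup:
  assumes s: "s \<in> prec_seqs S"
  shows "incr_seq (Cu_completion S) (\<lambda>n. embed (s n))"
    and "is_sup (Cu_completion S) (\<lambda>n. embed (s n)) (seq_class s)"
proof -
  have sS: "s n \<in> carrier S" for n using s by (rule prec_seqs_closed)
  show "incr_seq (Cu_completion S) (\<lambda>n. embed (s n))"
    using s by (auto simp: incr_seq_def embed_closed sS below_def prec_seqs_def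
        intro!: embed_leq below_leq_of_below)
  show "is_sup (Cu_completion S) (\<lambda>n. embed (s n)) (seq_class s)"
    unfolding is_sup_iff
  proof (intro conjI ballI allI impI)
    show "seq_class s \<in> carrier (Cu_completion S)" by (rule seq_class_closed[OF s])
    show "embed (s n) \<preceq>\<^bsub>Cu_completion S\<^esub> seq_class s" for n
      using approx[OF sS[of n]] s unfolding embed_def
      by (auto simp: completion_leq_iff seq_leq_def below_def)
    fix y assume y: "y \<in> carrier (Cu_completion S)"
      and ub: "\<forall>n. embed (s n) \<in> carrier (Cu_completion S) \<longrightarrow> embed (s n) \<preceq>\<^bsub>Cu_completion S\<^esub> y"
    obtain t where t: "t \<in> prec_seqs S" "y = seq_class t" using y by (rule carrier_completionE)
    have "seq_leq S s t"
      unfolding seq_leq_def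
    proof
      fix n
      \<comment> \<open>The shift to \<open>Suc n\<close> matters: the terms of
        \<open>approx (s n)\<close> need not dominate \<open>s n\<close>, but some term of
        \<open>approx (s (Suc n))\<close> does.\<close>
      have "s n \<in> below S (s (Suc n))" using s by (simp add: below_def prec_seqs_def)
      then obtain k where k: "s n \<prec>\<^bsub>S\<^esub> approx (s (Suc n)) k"
        using approx(3)[OF sS] by blast
      have "seq_leq S (approx (s (Suc n))) t"
        using ub embed_closed[OF sS, of "Suc n"] t approx(2)[OF sS]
        by (auto simp: embed_def completion_leq_iff)
      then obtain m where "approx (s (Suc n)) k \<prec>\<^bsub>S\<^esub> t m" by (auto simp: seq_leq_def)
      then show "\<exists>m. s n \<prec>\<^bsub>S\<^esub> t m"
        using k prec_trans[of "s n" "approx (s (Suc n)) k" "t m"] sS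
          prec_seqs_closed[OF approx(2)[OF sS]] prec_seqs_closed[OF t(1)] by blast
    qed
    then show "seq_class s \<preceq>\<^bsub>Cu_completion S\<^esub> y"
      using s t completion_leq_iff by blast
  qed
qed

section \<open>Restriction and extension of functionals\<close>

lemma Cu_functional_seq_class:
  assumes "m \<in> Cu_functionals (Cu_completion S)" "s \<in> prec_seqs S"
  shows "m (seq_class s) = (SUP n. m (embed (s n)))"
  by (rule Cu_functionalsD(3)[OF assms(1) embed_sup[OF assms(2)]])

text \<open>The supremum condition holds because \<open>embed a\<close> is the supremum of the
  images of the terms of \<open>approx a\<close>, which lie below \<open>a\<close>.\<close>

lemma restrict_Cu_functional:
  assumes m: "m \<in> Cu_functionals (Cu_completion S)"
  shows "compose (carrier S) m embed \<in> W_functionals S"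
proof -
  have le: "m (embed a) \<le> m (embed b)" if "a \<in> carrier S" "b \<in> carrier S" "below_leq S a b" for a b
    using that by (intro Cu_functionalsD(2)[OF m] embed_closed embed_leq)
  have "m (embed a) = (SUP b \<in> below S a. m (embed b))" if a: "a \<in> carrier S" for a
  proof (rule antisym)
    have "m (embed a) = (SUP n. m (embed (approx a n)))"
      using Cu_functional_seq_class[OF m approx(2)[OF a]] by (simp add: embed_def)
    also have "\<dots> \<le> (SUP b \<in> below S a. m (embed b))"
      using approx(1)[OF a] by (intro SUP_least SUP_upper)
    finally show "m (embed a) \<le> (SUP b \<in> below S a. m (embed b))" .
    show "(SUP b \<in> below S a. m (embed b)) \<le> m (embed a)"
      using a by (intro SUP_least le below_leq_of_below) (auto simp: below_def)
  qed
  moreover have "(SUP b \<in> below S a. compose (carrier S) m embed b) = (SUP b \<in> below S a. m (embed b))" for a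
    by (rule SUP_cong) (auto simp: compose_def below_def)
  ultimately have "compose (carrier S) m embed a = (SUP b \<in> below S a. compose (carrier S) m embed b)"
    if "a \<in> carrier S" for a
    using that by (simp add: compose_eq)
  moreover have "compose (carrier S) m embed \<in> additive_maps S"
    using Cu_functionalsD(1)[OF m]
    by (simp add: additive_maps_def compose_def embed_one embed_add embed_closed)
  ultimately show ?thesis
    using le unfolding W_functionals_def by (simp add: compose_eq)
qed

text \<open>The outer supremum runs over all representatives. For a functional \<open>l\<close> the
  inner one depends only on the class, so this merely avoids a choice.\<close>

definition extend_functional :: "('a \<Rightarrow> ennreal) \<Rightarrow> (nat \<Rightarrow> 'a) set \<Rightarrow> ennreal" where
  "extend_functional l = (\<lambda>x \<in> carrier (Cu_completion S). SUP s \<in> x. SUP n. l (s n))"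

lemma W_functional_seq_leq:
  assumes l: "l \<in> W_functionals S" and "s \<in> prec_seqs S" and t: "t \<in> prec_seqs S"
    and st: "seq_leq S s t"
  shows "(SUP n. l (s n)) \<le> (SUP n. l (t n))"
proof (rule SUP_mono)
  fix n
  obtain m where "s n \<in> below S (t m)"
    using st prec_seqs_closed[OF assms(2)] unfolding seq_leq_def below_def by blast
  then show "\<exists>m \<in> UNIV. l (s n) \<le> l (t m)"
    using W_functionals_mono[OF l prec_seqs_closed[OF t]] by blast
qed

lemma extend_functional_seq_class:
  assumes l: "l \<in> W_functionals S" and s: "s \<in> prec_seqs S"
  shows "extend_functional l (seq_class s) = (SUP n. l (s n))"
proof -
  have *: "(SUP n. l (t n)) = (SUP n. l (s n))" if "t \<in> seq_class s" for t
    using that W_functional_seq_leq[OF l] by (auto simp: seq_equiv_def intro!: antisym)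
  have "s \<in> seq_class s"
    by (rule equiv_class_self[OF equiv_seq_equiv s])
  then have "seq_class s \<noteq> {}" by blast
  then have "(SUP t \<in> seq_class s. SUP n. l (t n)) = (SUP n. l (s n))"
    by (rule SUP_eq_const) (rule *)
  then show ?thesis
    using seq_class_closed[OF s] by (simp add: extend_functional_def)
qed

lemma W_functional_incseq:
  assumes l: "l \<in> W_functionals S" and s: "s \<in> prec_seqs S"
  shows "incseq (\<lambda>n. l (s n))"
  using s by (auto intro!: incseq_SucI W_functionals_mono[OF l] simp: prec_seqs_def below_def)

text \<open>Additivity rests on suprema of increasing sequences commuting with sums, preservation of
  suprema on the sequence from \<open>diagonal_seq\<close>.\<close>

lemma extend_functional_mem:
  assumes l: "l \<in> W_functionals S"
  shows "extend_functional l \<in> Cu_functionals (Cu_completion S)"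
proof -
  let ?T = "Cu_completion S" and ?m = "extend_functional l"
  note ext = extend_functional_seq_class[OF l]
  have add: "l \<one> = 0" "\<And>a b. \<lbrakk>a \<in> carrier S; b \<in> carrier S\<rbrakk> \<Longrightarrow> l (a \<otimes> b) = l a + l b"
    using l by (auto simp: W_functionals_def additive_maps_def)
  have "?m (x \<otimes>\<^bsub>?T\<^esub> y) = ?m x + ?m y" if "x \<in> carrier ?T" "y \<in> carrier ?T" for x y
  proof -
    obtain s t where st: "s \<in> prec_seqs S" "x = seq_class s" "t \<in> prec_seqs S" "y = seq_class t"
      using \<open>x \<in> carrier ?T\<close> \<open>y \<in> carrier ?T\<close> by (metis carrier_completionE)
    then show ?thesis
      by (simp add: completion_add ext prec_seqs_add add prec_seqs_closed
          ennreal_SUP_add W_functional_incseq[OF l])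
  qed
  moreover have "?m \<one>\<^bsub>?T\<^esub> = 0"
    by (simp add: completion_one ext[OF prec_seqs_one] add)
  moreover have "?m \<in> extensional (carrier ?T)"
    by (simp add: extend_functional_def)
  moreover have mono: "?m x \<le> ?m y" if xy: "x \<in> carrier ?T" "y \<in> carrier ?T" "x \<preceq>\<^bsub>?T\<^esub> y" for x y
  proof -
    obtain s t where st: "s \<in> prec_seqs S" "x = seq_class s" "t \<in> prec_seqs S" "y = seq_class t"
      using xy by (metis carrier_completionE)
    then show ?thesis
      using xy(3) W_functional_seq_leq[OF l st(1,3)] by (simp add: completion_leq_iff ext)
  qed
  moreover have "?m x = (SUP k. ?m (z k))" if z: "incr_seq ?T z" and x: "is_sup ?T z x" for z x
  proof (rule antisym)
    obtain u where u: "\<And>k. u k \<in> prec_seqs S" "\<And>k. z k = seq_class (u k)"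
      "\<And>i j. i \<le> j \<Longrightarrow> seq_leq S (u i) (u j)"
      using incr_seq_completion_lift[OF z] by auto
    obtain v where v: "v \<in> prec_seqs S" "\<And>k. seq_leq S (u k) v" "\<And>n. \<exists>k j. v n \<prec>\<^bsub>S\<^esub> u k j"
      using diagonal_seq[of u, OF u(1) u(3)] by auto
    have "x \<preceq>\<^bsub>?T\<^esub> seq_class v"
      by (rule is_sup_least[OF x])
        (simp_all add: u(2) seq_class_closed[OF v(1)] completion_leq_iff[OF u(1) v(1)] v(2))
    then have "?m x \<le> ?m (seq_class v)"
      using mono x seq_class_closed[OF v(1)] by (auto simp: is_sup_iff)
    also have "\<dots> = (SUP n. l (v n))" by (rule ext[OF v(1)])
    \<comment> \<open>Every diagonal term is below an entry of some \<open>u k\<close>, so its value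
      is at most that of \<open>z k\<close>.\<close>
    also have "\<dots> \<le> (SUP k. ?m (z k))"
    proof (rule SUP_least)
      fix n
      obtain k j where "v n \<in> below S (u k j)"
        using v(3)[of n] prec_seqs_closed[OF v(1), of n] unfolding below_def by blast
      then have "l (v n) \<le> l (u k j)"
        using W_functionals_mono[OF l prec_seqs_closed[OF u(1)]] by blast
      also have "\<dots> \<le> (SUP j. l (u k j))" by (rule SUP_upper) simp
      also have "\<dots> = ?m (z k)" by (simp add: ext u)
      also have "\<dots> \<le> (SUP k. ?m (z k))" by (rule SUP_upper) simp
      finally show "l (v n) \<le> (SUP k. ?m (z k))" .
    qed
    finally show "?m x \<le> (SUP k. ?m (z k))" .
    show "(SUP k. ?m (z k)) \<le> ?m x"
      using z x by (intro SUP_least mono) (auto simp: is_sup_iff incr_seq_def)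
  qed
  ultimately show ?thesis
    by (auto simp: Cu_functionals_def additive_maps_def)
qed

text \<open>The terms of \<open>approx a\<close> are cofinal in \<open>below S a\<close>, so the
  extension takes at \<open>embed a\<close> the supremum of \<open>l\<close> over
  \<open>below S a\<close>, which is \<open>l a\<close>.\<close>

lemma compose_extend_functional:
  assumes l: "l \<in> W_functionals S"
  shows "compose (carrier S) (extend_functional l) embed = l"
proof (rule extensionalityI)
  show "l \<in> extensional (carrier S)" using l by (simp add: W_functionals_def additive_maps_def)
  fix a assume a: "a \<in> carrier S"
  have "(SUP n. l (approx a n)) = (SUP b \<in> below S a. l b)"
  proof (rule antisym)
    show "(SUP n. l (approx a n)) \<le> (SUP b \<in> below S a. l b)"
      using approx(1)[OF a] by (intro SUP_least SUP_upper)
    show "(SUP b \<in> below S a. l b) \<le> (SUP n. l (approx a n))"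
    proof (rule SUP_mono)
      fix b assume b: "b \<in> below S a"
      then obtain k where "b \<prec>\<^bsub>S\<^esub> approx a k" using approx(3)[OF a] by blast
      then show "\<exists>n \<in> UNIV. l b \<le> l (approx a n)"
        using W_functionals_mono[OF l, of "approx a k" b] b approx(1)[OF a, of k]
        by (auto simp: below_def)
    qed
  qed
  then show "compose (carrier S) (extend_functional l) embed a = l a"
    using l a extend_functional_seq_class[OF l approx(2)[OF a]]
    unfolding W_functionals_def by (simp add: compose_eq embed_def)
qed (simp add: compose_def)

lemma bij_betw_restrict_functional:
  "bij_betw (\<lambda>m. compose (carrier S) m embed) (Cu_functionals (Cu_completion S)) (W_functionals S)"
proof (rule bij_betwI[where g = extend_functional])
  show "extend_functional (compose (carrier S) m embed) = m"
    if m: "m \<in> Cu_functionals (Cu_completion S)" for m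
  proof (rule extensionalityI)
    show "m \<in> extensional (carrier (Cu_completion S))"
      using Cu_functionalsD(1)[OF m] by (simp add: additive_maps_def)
    fix x assume "x \<in> carrier (Cu_completion S)"
    then obtain s where s: "s \<in> prec_seqs S" "x = seq_class s" by (rule carrier_completionE)
    then show "extend_functional (compose (carrier S) m embed) x = m x"
      by (simp add: extend_functional_seq_class restrict_Cu_functional[OF m]
          Cu_functional_seq_class[OF m] compose_eq prec_seqs_closed)
  qed (simp add: extend_functional_def)
qed (auto simp: restrict_Cu_functional extend_functional_mem compose_extend_functional)

section \<open>Convergence under restriction and the first homeomorphism\<close>

text \<open>Forwards, \<open>b \<prec> a\<close> becomes \<open>embed b \<lless> embed a\<close>.
  Backwards, an element way below the class of \<open>s\<close> is at most
  \<open>embed (s n)\<close> for some \<open>n\<close>, which handles upper limits; the bound for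
  lower limits passes to the supremum over \<open>n\<close>.\<close>

lemma functional_conv_restrict:
  assumes m: "m \<in> Cu_functionals (Cu_completion S)"
    and F: "eventually (\<lambda>f. f \<in> Cu_functionals (Cu_completion S)) F"
  shows "functional_conv (way_below_monoid (Cu_completion S)) (\<lambda>f. f) m F \<longleftrightarrow>
    functional_conv S (\<lambda>f. compose (carrier S) f embed) (compose (carrier S) m embed) F"
proof
  let ?T = "Cu_completion S"
  assume conv: "functional_conv (way_below_monoid ?T) (\<lambda>f. f) m F"
  show "functional_conv S (\<lambda>f. compose (carrier S) f embed) (compose (carrier S) m embed) F"
    unfolding functional_conv_def
  proof (intro ballI)
    fix a b assume a: "a \<in> carrier S" and b: "b \<in> below S a"
    then have bS: "b \<in> carrier S" by (simp add: below_def)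
    have "embed b \<in> below (way_below_monoid ?T) (embed a)"
      using embed_way_below[OF a b] embed_closed[OF bS]
      by (simp add: below_def way_below_monoid_def)
    moreover have "embed a \<in> carrier (way_below_monoid ?T)"
      using embed_closed[OF a] by (simp add: way_below_monoid_def)
    ultimately show "Limsup F (\<lambda>f. compose (carrier S) f embed b) \<le> compose (carrier S) m embed a \<and>
        compose (carrier S) m embed a \<le> Liminf F (\<lambda>f. compose (carrier S) f embed a)"
      using conv a bS unfolding functional_conv_def by (simp add: compose_def)
  qed
next
  let ?T = "Cu_completion S"
  assume "functional_conv S (\<lambda>f. compose (carrier S) f embed) (compose (carrier S) m embed) F"
  then have conv: "Limsup F (\<lambda>f. f (embed b)) \<le> m (embed a)" "m (embed a) \<le> Liminf F (\<lambda>f. f (embed a))"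
    if "a \<in> carrier S" "b \<in> below S a" for a b
    using that by (auto simp: functional_conv_def compose_def below_def)
  show "functional_conv (way_below_monoid ?T) (\<lambda>f. f) m F"
    unfolding functional_conv_def
  proof (intro ballI conjI)
    fix x y
    assume "x \<in> carrier (way_below_monoid ?T)" and "y \<in> below (way_below_monoid ?T) x"
    then have x: "x \<in> carrier ?T" and y: "y \<in> carrier ?T" "way_below ?T y x"
      by (auto simp: way_below_monoid_def below_def)
    obtain s where s: "s \<in> prec_seqs S" "x = seq_class s" using x by (rule carrier_completionE)
    note sS = prec_seqs_closed[OF s(1)]
    have s': "s n \<in> below S (s (Suc n))" for n
      using s(1) by (simp add: below_def prec_seqs_def)
    note mx = Cu_functional_seq_class[OF _ s(1), folded s(2)]
    have "x \<preceq>\<^bsub>?T\<^esub> x" using s seq_leq_refl by (simp add: completion_leq_iff)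
    then obtain n where n: "y \<preceq>\<^bsub>?T\<^esub> embed (s n)"
      using y(2) embed_sup[OF s(1)] s(2) unfolding way_below_def by blast
    have "Limsup F (\<lambda>f. f y) \<le> Limsup F (\<lambda>f. f (embed (s n)))"
      by (rule Limsup_mono, use F in eventually_elim)
        (use n y(1) embed_closed[OF sS] in \<open>blast intro: Cu_functionalsD(2)\<close>)
    \<comment> \<open>Convergence bounds upper limits only across a pair such as
      \<open>s n \<prec> s (Suc n)\<close>, at the cost of one index.\<close>
    also have "\<dots> \<le> m (embed (s (Suc n)))" by (rule conv(1)[OF sS s'])
    also have "\<dots> \<le> m x" unfolding mx[OF m] by (rule SUP_upper) simp
    finally show "Limsup F (\<lambda>f. f y) \<le> m x" .
    have "m (embed (s n)) \<le> Liminf F (\<lambda>f. f x)" for n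
    proof -
      \<comment> \<open>Convergence is stated for pairs of related elements; a term of
        \<open>approx (s n)\<close> completes the pair here.\<close>
      have "m (embed (s n)) \<le> Liminf F (\<lambda>f. f (embed (s n)))"
        using conv(2)[OF sS approx(1)[OF sS]] .
      also have "\<dots> \<le> Liminf F (\<lambda>f. f x)"
        by (rule Liminf_mono, use F in eventually_elim) (simp add: mx, rule SUP_upper, simp)
      finally show ?thesis .
    qed
    then show "m x \<le> Liminf F (\<lambda>f. f x)" unfolding mx[OF m] by (rule SUP_least)
  qed
qed

theorem affine_homeomorphism_restrict:
  "affine_homeomorphism (carrier (Cu_completion S)) (Cu_functional_space (Cu_completion S))
     (carrier S) (W_functional_space S) (\<lambda>m. compose (carrier S) m embed)"
  unfolding affine_homeomorphism_def Cu_functional_space_def W_functional_space_def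
  by (intro conjI ballI allI impI homeomorphic_map_functional_topology bij_betw_restrict_functional
      functional_conv_restrict compose_cone_comb embed_closed)

text \<open>The inverse of restriction along \<open>embed\<close>; what remains is that the
  Cu-functionals on the completion are closed under cone combinations.\<close>

theorem affine_homeomorphism_completion:
  "\<exists>h. affine_homeomorphism (carrier S) (W_functional_space S)
     (carrier (Cu_completion S)) (Cu_functional_space (Cu_completion S)) h"
proof (rule affine_homeomorphism_inverse[OF affine_homeomorphism_restrict])
  have one: "\<one>\<^bsub>Cu_completion S\<^esub> \<in> carrier (Cu_completion S)"
    by (simp add: completion_one seq_class_closed prec_seqs_one)
  have mult: "x \<otimes>\<^bsub>Cu_completion S\<^esub> y \<in> carrier (Cu_completion S)"
    if xy: "x \<in> carrier (Cu_completion S)" "y \<in> carrier (Cu_completion S)" for x y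
  proof -
    obtain s where s: "s \<in> prec_seqs S" "x = seq_class s" using xy(1) by (rule carrier_completionE)
    obtain t where t: "t \<in> prec_seqs S" "y = seq_class t" using xy(2) by (rule carrier_completionE)
    show ?thesis
      using s t by (simp add: completion_add seq_class_closed prec_seqs_add)
  qed
  show "cone_comb (carrier (Cu_completion S)) r l t m \<in> topspace (Cu_functional_space (Cu_completion S))"
    if "l \<in> topspace (Cu_functional_space (Cu_completion S))"
      "m \<in> topspace (Cu_functional_space (Cu_completion S))" for l m r t
    using that Cu_functionals_cone_comb[OF one mult] by (simp add: Cu_functional_space_def)
qed

end

section \<open>Functionals on the quotient\<close>

context G_W_semigroup
begin

section \<open>The orbit preorder and its interpolation property\<close>

abbreviation orb_leq :: "'a \<Rightarrow> 'a \<Rightarrow> bool" (infix "\<le>\<^sub>G" 50) where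
  "a \<le>\<^sub>G b \<equiv> orbit_leq G S \<phi> a b"

abbreviation proj :: "'a \<Rightarrow> 'a set" where
  "proj \<equiv> quot_map G S \<phi>"

lemma act_closed: "\<lbrakk>g \<in> carrier G; a \<in> carrier S\<rbrakk> \<Longrightarrow> \<phi> g a \<in> carrier S"
  using element_image by blast

lemma inv_act_closed: "g \<in> carrier G \<Longrightarrow> inv\<^bsub>G\<^esub> g \<in> carrier G"
  using group_hom group.inv_closed[of G] by (auto simp: group_hom_def)

lemma below_closed: "b \<in> below S a \<Longrightarrow> b \<in> carrier S"
  by (simp add: below_def)

lemma orbit_leq_closed: "a \<le>\<^sub>G b \<Longrightarrow> a \<in> carrier S \<and> b \<in> carrier S"
  by (induction rule: orbit_leq.induct) (auto intro: act_closed)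

lemma orb_leq_refl: "a \<in> carrier S \<Longrightarrow> a \<le>\<^sub>G a"
  by (rule orbit_leq_refl)

lemma orb_leq_trans: "\<lbrakk>a \<le>\<^sub>G b; b \<le>\<^sub>G c\<rbrakk> \<Longrightarrow> a \<le>\<^sub>G c"
  by (rule orbit_leq_trans)

lemma orbit_leq_of_below: "\<lbrakk>b \<in> carrier S; a \<in> below S b\<rbrakk> \<Longrightarrow> a \<le>\<^sub>G b"
  using below_leq_of_below[of b a] by (auto simp: below_leq_def below_closed intro: orbit_leq_below)

lemma orbit_leq_sym_orbit:
  assumes "g \<in> carrier G" "a \<in> carrier S"
  shows "a \<le>\<^sub>G \<phi> g a"
  using orbit_leq_orbit[OF act_closed[OF assms] inv_act_closed[OF assms(1)], where \<phi> = \<phi>]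
    orbit_sym_aux[OF assms refl] by simp

text \<open>Induction over the generating rules: inclusion of lower sets keeps \<open>c\<close>, the
  orbit rule translates it by an inverse, the limit rule inserts an element between \<open>c\<close>
  and \<open>a\<close>, and sums are split by (W4) and reassembled by (W3).\<close>

lemma orbit_leq_interpolate:
  assumes "a \<le>\<^sub>G b" "c \<in> below S a"
  shows "\<exists>d \<in> below S b. c \<le>\<^sub>G d"
  using assms
proof (induction arbitrary: c rule: orbit_leq.induct)
  case (orbit_leq_refl a)
  then show ?case by (intro bexI[of _ c] orb_leq_refl below_closed)
next
  case (orbit_leq_trans a b e)
  then obtain d where "d \<in> below S b" "c \<le>\<^sub>G d" by blast
  moreover obtain d' where "d' \<in> below S e" "d \<le>\<^sub>G d'"
    using orbit_leq_trans.IH(2) calculation(1) by blast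
  ultimately show ?case using orb_leq_trans by blast
next
  case (orbit_leq_below a b)
  then have "c \<in> below S b" by blast
  then show ?case by (intro bexI[of _ c] orb_leq_refl below_closed)
next
  case (orbit_leq_orbit b g)
  let ?d = "\<phi> (inv\<^bsub>G\<^esub> g) c"
  have c: "c \<in> carrier S" "c \<prec>\<^bsub>S\<^esub> \<phi> g b"
    using orbit_leq_orbit.prems by (auto simp: below_def)
  note g' = inv_act_closed[OF orbit_leq_orbit.hyps(2)]
  have "?d \<prec>\<^bsub>S\<^esub> \<phi> (inv\<^bsub>G\<^esub> g) (\<phi> g b)"
    using act_prec[OF g' c(1) act_closed c(2)] orbit_leq_orbit.hyps by blast
  also have "\<phi> (inv\<^bsub>G\<^esub> g) (\<phi> g b) = b"
    using orbit_sym_aux[OF _ _ refl] orbit_leq_orbit.hyps by blast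
  finally have "?d \<in> below S b" using act_closed[OF g' c(1)] by (simp add: below_def)
  then show ?case using orbit_leq_sym_orbit[OF g' c(1)] by blast
next
  case (orbit_leq_limit a b)
  \<comment> \<open>The induction hypothesis speaks of what lies below some element below
    \<open>a\<close>, so \<open>c\<close> is first placed under an approximant of
    \<open>a\<close>.\<close>
  obtain k where k: "c \<prec>\<^bsub>S\<^esub> approx a k"
    using approx(3)[OF orbit_leq_limit.hyps(1) orbit_leq_limit.prems] by blast
  then have "c \<in> below S (approx a k)"
    using below_closed[OF orbit_leq_limit.prems] by (simp add: below_def)
  then show ?case
    using orbit_leq_limit.IH[OF approx(1)[OF orbit_leq_limit.hyps(1)]] by blast
next
  case (orbit_leq_add a1 b1 a2 b2)
  note cl = orbit_leq_closed[OF orbit_leq_add.hyps(1)] orbit_leq_closed[OF orbit_leq_add.hyps(2)]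
  obtain c1 c2 where c: "c1 \<in> below S a1" "c2 \<in> below S a2" "c \<prec>\<^bsub>S\<^esub> c1 \<otimes>\<^bsub>S\<^esub> c2"
    using W4[OF _ _ orbit_leq_add.prems] cl by blast
  obtain d1 d2 where d: "d1 \<in> below S b1" "c1 \<le>\<^sub>G d1" "d2 \<in> below S b2" "c2 \<le>\<^sub>G d2"
    using orbit_leq_add.IH c by meson
  have "c \<le>\<^sub>G c1 \<otimes>\<^bsub>S\<^esub> c2"
    using c(3) below_closed[OF c(1)] below_closed[OF c(2)] below_closed[OF orbit_leq_add.prems]
    by (intro orbit_leq_of_below) (simp_all add: below_def)
  then have "c \<le>\<^sub>G d1 \<otimes>\<^bsub>S\<^esub> d2"
    by (rule orb_leq_trans[OF _ orbit_leq.orbit_leq_add[OF d(2,4)]])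
  moreover have "d1 \<otimes>\<^bsub>S\<^esub> d2 \<in> below S (b1 \<otimes>\<^bsub>S\<^esub> b2)"
    using W3[OF _ _ d(1,3)] cl below_closed[OF d(1)] below_closed[OF d(3)]
    by (simp add: below_def)
  ultimately show ?case by blast
qed

section \<open>The quotient as a W-semigroup\<close>

lemma equiv_orbit_equiv: "equiv (carrier S) (orbit_equiv G S \<phi>)"
  by (rule equivI) (auto simp: refl_on_def sym_def trans_def orbit_equiv_def
      intro: orb_leq_refl orb_leq_trans)

lemma proj_closed: "a \<in> carrier S \<Longrightarrow> proj a \<in> carrier (quot G S \<phi>)"
  by (simp add: quot_def quot_map_def quotientI)

lemma carrier_quotE:
  assumes "A \<in> carrier (quot G S \<phi>)"
  obtains a where "a \<in> carrier S" "A = proj a"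
  using assms by (auto simp: quot_def quot_map_def elim: quotientE)

lemma proj_eq_iff:
  "\<lbrakk>a \<in> carrier S; b \<in> carrier S\<rbrakk> \<Longrightarrow> proj a = proj b \<longleftrightarrow> a \<le>\<^sub>G b \<and> b \<le>\<^sub>G a"
  using eq_equiv_class_iff[OF equiv_orbit_equiv] by (auto simp: quot_map_def orbit_equiv_def)

text \<open>The relation on the quotient admits arbitrary representatives on both sides;
  interpolation replaces the one on the right by \<open>b\<close>.\<close>

lemma quot_prec_iff:
  assumes a: "a \<in> carrier S" and b: "b \<in> carrier S"
  shows "proj a \<prec>\<^bsub>quot G S \<phi>\<^esub> proj b \<longleftrightarrow> (\<exists>b' \<in> below S b. a \<le>\<^sub>G b')"
proof
  assume "proj a \<prec>\<^bsub>quot G S \<phi>\<^esub> proj b"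
  then obtain a0 b0 c where *: "a \<le>\<^sub>G a0" "b0 \<le>\<^sub>G b" "c \<in> below S b0" "a0 \<le>\<^sub>G c"
    by (auto simp: quot_def quot_map_def orbit_equiv_def)
  then show "\<exists>b' \<in> below S b. a \<le>\<^sub>G b'"
    using orbit_leq_interpolate[OF *(2,3)] by (meson orb_leq_trans)
next
  assume "\<exists>b' \<in> below S b. a \<le>\<^sub>G b'"
  then show "proj a \<prec>\<^bsub>quot G S \<phi>\<^esub> proj b"
    using a b by (auto simp: quot_def quot_map_def orbit_equiv_def intro: orb_leq_refl)
qed

lemma quot_mult:
  assumes "a \<in> carrier S" "b \<in> carrier S"
  shows "proj a \<otimes>\<^bsub>quot G S \<phi>\<^esub> proj b = proj (a \<otimes>\<^bsub>S\<^esub> b)"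
proof -
  have "congruent2 (orbit_equiv G S \<phi>) (orbit_equiv G S \<phi>) (\<lambda>a b. proj (a \<otimes>\<^bsub>S\<^esub> b))"
  proof (rule congruent2I')
    fix a a' b b' assume "(a, a') \<in> orbit_equiv G S \<phi>" "(b, b') \<in> orbit_equiv G S \<phi>"
    then show "proj (a \<otimes>\<^bsub>S\<^esub> b) = proj (a' \<otimes>\<^bsub>S\<^esub> b')"
      by (subst proj_eq_iff) (auto simp: orbit_equiv_def intro: orbit_leq_add)
  qed
  then show ?thesis
    using UN_equiv_class2[OF equiv_orbit_equiv equiv_orbit_equiv] assms
    by (simp add: quot_def quot_map_def)
qed

lemma quot_one: "\<one>\<^bsub>quot G S \<phi>\<^esub> = proj \<one>\<^bsub>S\<^esub>"
  by (simp add: quot_def)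

lemma quot_below_iff:
  assumes "a \<in> carrier S" "b \<in> carrier S"
  shows "proj a \<in> below (quot G S \<phi>) (proj b) \<longleftrightarrow> (\<exists>b' \<in> below S b. a \<le>\<^sub>G b')"
  using quot_prec_iff[OF assms] proj_closed[OF assms(1)] by (simp add: below_def)

lemma comm_monoid_quot: "comm_monoid (quot G S \<phi>)"
proof (rule comm_monoidI)
  let ?Q = "quot G S \<phi>"
  show "\<one>\<^bsub>?Q\<^esub> \<in> carrier ?Q" by (simp add: quot_one proj_closed)
  fix x y z assume "x \<in> carrier ?Q" "y \<in> carrier ?Q" "z \<in> carrier ?Q"
  then obtain a b c where abc: "a \<in> carrier S" "x = proj a" "b \<in> carrier S" "y = proj b"
    "c \<in> carrier S" "z = proj c"
    by (metis carrier_quotE)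
  show "x \<otimes>\<^bsub>?Q\<^esub> y \<in> carrier ?Q" "x \<otimes>\<^bsub>?Q\<^esub> y \<otimes>\<^bsub>?Q\<^esub> z = x \<otimes>\<^bsub>?Q\<^esub> (y \<otimes>\<^bsub>?Q\<^esub> z)"
    "\<one>\<^bsub>?Q\<^esub> \<otimes>\<^bsub>?Q\<^esub> x = x"
    using abc by (simp_all add: quot_mult quot_one proj_closed m_assoc)
  show "x \<otimes>\<^bsub>?Q\<^esub> y = y \<otimes>\<^bsub>?Q\<^esub> x"
    using abc m_comm[OF abc(1,3)] by (simp add: quot_mult)
qed

text \<open>Through \<open>quot_prec_iff\<close> every axiom reduces to properties of
  \<open>S\<close>, since \<open>\<le>\<^sub>G\<close> contains \<open>\<prec>\<close> and is
  compatible with sums.\<close>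

lemma W_semigroup_quot: "W_semigroup (quot G S \<phi>)"
proof (rule W_semigroup.intro[OF comm_monoid_quot], rule W_semigroup_axioms.intro)
  let ?Q = "quot G S \<phi>"
  show "x \<prec>\<^bsub>?Q\<^esub> z"
    if mem: "x \<in> carrier ?Q" "y \<in> carrier ?Q" "z \<in> carrier ?Q"
      and prec: "x \<prec>\<^bsub>?Q\<^esub> y" "y \<prec>\<^bsub>?Q\<^esub> z" for x y z
  proof -
    obtain a where a: "a \<in> carrier S" "x = proj a" using mem(1) by (rule carrier_quotE)
    obtain b where b: "b \<in> carrier S" "y = proj b" using mem(2) by (rule carrier_quotE)
    obtain c where c: "c \<in> carrier S" "z = proj c" using mem(3) by (rule carrier_quotE)
    obtain b' where b': "b' \<in> below S b" "a \<le>\<^sub>G b'"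
      using prec(1) quot_prec_iff[OF a(1) b(1)] a b by auto
    obtain c' where c': "c' \<in> below S c" "b \<le>\<^sub>G c'"
      using prec(2) quot_prec_iff[OF b(1) c(1)] b c by auto
    have "a \<le>\<^sub>G c'"
      using b'(2) orbit_leq_of_below[OF b(1) b'(1)] c'(2) by (meson orb_leq_trans)
    then show ?thesis
      using quot_prec_iff[OF a(1) c(1)] a c c'(1) by auto
  qed
  show "\<one>\<^bsub>?Q\<^esub> \<prec>\<^bsub>?Q\<^esub> x" if x: "x \<in> carrier ?Q" for x
  proof -
    obtain a where a: "a \<in> carrier S" "x = proj a" using x by (rule carrier_quotE)
    have "\<one>\<^bsub>S\<^esub> \<in> below S a" using zero_prec[OF a(1)] by (simp add: below_def)
    then show ?thesis
      using a quot_prec_iff[OF one_closed a(1)] orb_leq_refl[OF one_closed]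
      by (auto simp: quot_one)
  qed
  show "\<exists>s :: nat \<Rightarrow> _. (\<forall>k. s k \<in> below ?Q x) \<and> (\<forall>k. s k \<prec>\<^bsub>?Q\<^esub> s (Suc k)) \<and>
      (\<forall>y \<in> below ?Q x. \<exists>k. y \<prec>\<^bsub>?Q\<^esub> s k)" if x: "x \<in> carrier ?Q" for x
  proof -
    obtain a where a: "a \<in> carrier S" "x = proj a" using x by (rule carrier_quotE)
    note ap = approx[OF a(1)] and apS = below_closed[OF approx(1)[OF a(1)]]
    show ?thesis
    \<comment> \<open>The image of an approximating sequence of a representative serves in the
      quotient.\<close>
    proof (intro exI[of _ "\<lambda>k. proj (approx a k)"] conjI allI ballI)
      show "proj (approx a k) \<in> below ?Q x" for k
        using quot_below_iff[OF apS a(1), of k] ap(1)[of k] orb_leq_refl[OF apS, of k] a(2)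
        by auto
      show "proj (approx a k) \<prec>\<^bsub>?Q\<^esub> proj (approx a (Suc k))" for k
        using quot_prec_iff[OF apS apS, of k "Suc k"] ap(2) orb_leq_refl[OF apS, of k] apS[of k]
        by (auto simp: prec_seqs_def below_def)
      fix y assume y: "y \<in> below ?Q x"
      then have "y \<in> carrier ?Q" by (simp add: below_def)
      then obtain b where b: "b \<in> carrier S" "y = proj b" by (rule carrier_quotE)
      obtain a' where a': "a' \<in> below S a" "b \<le>\<^sub>G a'"
        using y quot_below_iff[OF b(1) a(1)] a b by auto
      obtain k where "a' \<prec>\<^bsub>S\<^esub> approx a k" using ap(3)[OF a'(1)] by blast
      then have "a' \<in> below S (approx a k)" using below_closed[OF a'(1)] by (simp add: below_def)
      then show "\<exists>k. y \<prec>\<^bsub>?Q\<^esub> proj (approx a k)"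
        using quot_prec_iff[OF b(1) apS] b a'(2) by auto
    qed
  qed
  show "x' \<otimes>\<^bsub>?Q\<^esub> y' \<prec>\<^bsub>?Q\<^esub> x \<otimes>\<^bsub>?Q\<^esub> y"
    if mem: "x \<in> carrier ?Q" "y \<in> carrier ?Q" and below: "x' \<in> below ?Q x" "y' \<in> below ?Q y" for x y x' y'
  proof -
    have mem': "x' \<in> carrier ?Q" "y' \<in> carrier ?Q" using below by (auto simp: below_def)
    obtain a where a: "a \<in> carrier S" "x = proj a" using mem(1) by (rule carrier_quotE)
    obtain b where b: "b \<in> carrier S" "y = proj b" using mem(2) by (rule carrier_quotE)
    obtain c where c: "c \<in> carrier S" "x' = proj c" using mem'(1) by (rule carrier_quotE)
    obtain d where d: "d \<in> carrier S" "y' = proj d" using mem'(2) by (rule carrier_quotE)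
    obtain a' where a': "a' \<in> below S a" "c \<le>\<^sub>G a'"
      using below(1) quot_below_iff[OF c(1) a(1)] a c by auto
    obtain b' where b': "b' \<in> below S b" "d \<le>\<^sub>G b'"
      using below(2) quot_below_iff[OF d(1) b(1)] b d by auto
    have "a' \<otimes>\<^bsub>S\<^esub> b' \<in> below S (a \<otimes>\<^bsub>S\<^esub> b)"
      using W3[OF a(1) b(1) a'(1) b'(1)] below_closed[OF a'(1)] below_closed[OF b'(1)]
      by (simp add: below_def)
    then have "proj (c \<otimes>\<^bsub>S\<^esub> d) \<prec>\<^bsub>?Q\<^esub> proj (a \<otimes>\<^bsub>S\<^esub> b)"
      using quot_prec_iff[of "c \<otimes>\<^bsub>S\<^esub> d" "a \<otimes>\<^bsub>S\<^esub> b"] orbit_leq_add[OF a'(2) b'(2)] a b c d by auto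
    then show ?thesis using a b c d by (simp add: quot_mult)
  qed
  show "\<exists>y' \<in> below ?Q y. \<exists>z' \<in> below ?Q z. x \<prec>\<^bsub>?Q\<^esub> y' \<otimes>\<^bsub>?Q\<^esub> z'"
    if mem: "y \<in> carrier ?Q" "z \<in> carrier ?Q" and x: "x \<in> below ?Q (y \<otimes>\<^bsub>?Q\<^esub> z)" for x y z
  proof -
    have mem': "x \<in> carrier ?Q" using x by (simp add: below_def)
    obtain a where a: "a \<in> carrier S" "x = proj a" using mem' by (rule carrier_quotE)
    obtain b where b: "b \<in> carrier S" "y = proj b" using mem(1) by (rule carrier_quotE)
    obtain c where c: "c \<in> carrier S" "z = proj c" using mem(2) by (rule carrier_quotE)
    obtain a' where a': "a' \<in> below S (b \<otimes>\<^bsub>S\<^esub> c)" "a \<le>\<^sub>G a'"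
      using x quot_below_iff[of a "b \<otimes>\<^bsub>S\<^esub> c"] a b c by (auto simp: quot_mult)
    obtain b' c' where bc: "b' \<in> below S b" "c' \<in> below S c" "a' \<prec>\<^bsub>S\<^esub> b' \<otimes>\<^bsub>S\<^esub> c'"
      using W4[OF b(1) c(1) a'(1)] by blast
    note cl = below_closed[OF bc(1)] below_closed[OF bc(2)] below_closed[OF a'(1)]
    have "proj b' \<in> below ?Q y" "proj c' \<in> below ?Q z"
      using quot_below_iff[OF cl(1) b(1)] quot_below_iff[OF cl(2) c(1)] b c bc(1,2)
        orb_leq_refl[OF cl(1)] orb_leq_refl[OF cl(2)] by auto
    moreover have "x \<prec>\<^bsub>?Q\<^esub> proj b' \<otimes>\<^bsub>?Q\<^esub> proj c'"
      using quot_prec_iff[of a "b' \<otimes>\<^bsub>S\<^esub> c'"] a a'(2) bc(3) cl by (auto simp: quot_mult below_def)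
    ultimately show ?thesis by blast
  qed
qed

text \<open>The limit rule gives the forward direction, interpolation the backward one. Hence
  monotonicity of a functional on the quotient amounts to monotonicity for
  \<open>\<le>\<^sub>G\<close>.\<close>

lemma quot_below_leq:
  assumes a: "a \<in> carrier S" and b: "b \<in> carrier S"
  shows "below_leq (quot G S \<phi>) (proj a) (proj b) \<longleftrightarrow> a \<le>\<^sub>G b"
proof
  assume le: "below_leq (quot G S \<phi>) (proj a) (proj b)"
  show "a \<le>\<^sub>G b"
  proof (rule orbit_leq_limit[OF a b])
    fix c assume c: "c \<in> below S a"
    note cS = below_closed[OF c]
    have "proj c \<in> below (quot G S \<phi>) (proj a)"
      using quot_below_iff[OF cS a] c orb_leq_refl[OF cS] by blast
    then have "\<exists>b' \<in> below S b. c \<le>\<^sub>G b'"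
      using le quot_below_iff[OF cS b] unfolding below_leq_def by blast
    then show "c \<le>\<^sub>G b"
      using orbit_leq_of_below[OF b] by (meson orb_leq_trans)
  qed
next
  assume ab: "a \<le>\<^sub>G b"
  show "below_leq (quot G S \<phi>) (proj a) (proj b)"
    unfolding below_leq_def
  proof
    fix x assume x: "x \<in> below (quot G S \<phi>) (proj a)"
    then have "x \<in> carrier (quot G S \<phi>)" by (simp add: below_def)
    then obtain c where c: "c \<in> carrier S" "x = proj c" by (rule carrier_quotE)
    obtain a' where "a' \<in> below S a" "c \<le>\<^sub>G a'"
      using x quot_below_iff[OF c(1) a] c by auto
    then have "\<exists>b' \<in> below S b. c \<le>\<^sub>G b'"
      using orbit_leq_interpolate[OF ab] by (meson orb_leq_trans)
    then show "x \<in> below (quot G S \<phi>) (proj b)"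
      using quot_below_iff[OF c(1) b] c by auto
  qed
qed


section \<open>Invariant functionals and functionals on the quotient\<close>

text \<open>The preorder \<open>l a \<le> l b\<close> satisfies all generating rules of
  \<open>\<le>\<^sub>G\<close>: the limit rule by the supremum condition, the orbit rule by
  invariance, the remaining ones by monotonicity and additivity.\<close>

lemma invariant_functional_orbit_leq:
  assumes l: "l \<in> W_functionals S" and inv: "l \<in> invariant_functionals G (carrier S) \<phi>"
  shows "a \<le>\<^sub>G b \<Longrightarrow> l a \<le> l b"
proof (induction rule: orbit_leq.induct)
  case (orbit_leq_below a b)
  then show ?case
    using l unfolding W_functionals_def below_leq_def by blast
next
  case (orbit_leq_orbit b g)
  then show ?case using inv by (simp add: invariant_functionals_def)
next
  case (orbit_leq_limit a b)
  have "l a = (SUP c \<in> below S a. l c)"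
    using l orbit_leq_limit.hyps(1) unfolding W_functionals_def by blast
  also have "\<dots> \<le> l b" by (rule SUP_least) (rule orbit_leq_limit.IH)
  finally show ?case .
next
  case (orbit_leq_add a1 b1 a2 b2)
  have "l (a \<otimes>\<^bsub>S\<^esub> b) = l a + l b" if "a \<in> carrier S" "b \<in> carrier S" for a b
    using W_functionals_additive[OF l] that by (simp add: additive_maps_def)
  then show ?case
    using orbit_leq_closed[OF orbit_leq_add.hyps(1)] orbit_leq_closed[OF orbit_leq_add.hyps(2)]
      orbit_leq_add.IH by (simp add: add_mono)
qed auto

text \<open>Whatever lies below \<open>proj a\<close> is at most some \<open>proj b\<close> with
  \<open>b \<prec> a\<close>, so the supremum may be taken over the images of
  \<open>below S a\<close>.\<close>

lemma W_functional_quot_SUP: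
  assumes l: "l \<in> W_functionals (quot G S \<phi>)" and a: "a \<in> carrier S"
  shows "l (proj a) = (SUP b \<in> below S a. l (proj b))"
proof (rule antisym)
  let ?Q = "quot G S \<phi>"
  have mono: "l (proj b) \<le> l (proj c)" if "b \<le>\<^sub>G c" for b c
    using l orbit_leq_closed[OF that] that quot_below_leq[of b c] proj_closed
    unfolding W_functionals_def by blast
  have "l (proj a) = (SUP x \<in> below ?Q (proj a). l x)"
    using l proj_closed[OF a] unfolding W_functionals_def by blast
  also have "\<dots> \<le> (SUP b \<in> below S a. l (proj b))"
  proof (rule SUP_mono)
    fix x assume x: "x \<in> below ?Q (proj a)"
    then have "x \<in> carrier ?Q" by (simp add: below_def)
    then obtain c where c: "c \<in> carrier S" "x = proj c" by (rule carrier_quotE)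
    then obtain b where "b \<in> below S a" "c \<le>\<^sub>G b"
      using x quot_below_iff[OF c(1) a] by auto
    then show "\<exists>b \<in> below S a. l x \<le> l (proj b)"
      using mono c(2) by blast
  qed
  finally show "l (proj a) \<le> (SUP b \<in> below S a. l (proj b))" .
  show "(SUP b \<in> below S a. l (proj b)) \<le> l (proj a)"
    by (rule SUP_least) (rule mono[OF orbit_leq_of_below[OF a]])
qed

text \<open>Monotonicity survives because \<open>\<le>\<^sub>G\<close> extends the order of
  \<open>S\<close>; invariance holds because \<open>a\<close> and \<open>\<phi> g a\<close> have the
  same class.\<close>

lemma compose_proj_mem:
  assumes l: "l \<in> W_functionals (quot G S \<phi>)"
  shows "compose (carrier S) l proj \<in> W_functionals S \<inter> invariant_functionals G (carrier S) \<phi>"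
proof
  let ?Q = "quot G S \<phi>" and ?l = "compose (carrier S) l proj"
  have "?l \<in> additive_maps S"
    using W_functionals_additive[OF l]
    by (auto simp: additive_maps_def compose_eq quot_one quot_mult[symmetric] proj_closed)
  moreover have "?l a \<le> ?l b" if ab: "a \<in> carrier S" "b \<in> carrier S" "below_leq S a b" for a b
  proof -
    have "below_leq ?Q (proj a) (proj b)"
      using ab quot_below_leq[OF ab(1,2)] orbit_leq_below[OF ab(1,2)] by (simp add: below_leq_def)
    then have "l (proj a) \<le> l (proj b)"
      using l proj_closed ab unfolding W_functionals_def by blast
    then show ?thesis using ab by (simp add: compose_eq)
  qed
  moreover have "?l a = (SUP b \<in> below S a. ?l b)" if a: "a \<in> carrier S" for a
  proof -
    have "(SUP b \<in> below S a. ?l b) = (SUP b \<in> below S a. l (proj b))"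
      by (rule SUP_cong) (auto simp: compose_def below_def)
    then show ?thesis using a W_functional_quot_SUP[OF l a] by (simp add: compose_eq)
  qed
  ultimately show "?l \<in> W_functionals S" unfolding W_functionals_def by blast
  have "proj (\<phi> g a) = proj a" if "g \<in> carrier G" "a \<in> carrier S" for g a
    using that orbit_leq_orbit[OF that(2,1), where \<phi> = \<phi>] orbit_leq_sym_orbit[OF that]
    by (simp add: proj_eq_iff act_closed)
  then show "?l \<in> invariant_functionals G (carrier S) \<phi>"
    by (simp add: invariant_functionals_def compose_eq act_closed)
qed

text \<open>An invariant functional is constant on each class, so the supremum only spares the
  choice of a representative.\<close>

definition descend_functional :: "('a \<Rightarrow> ennreal) \<Rightarrow> 'a set \<Rightarrow> ennreal" where
  "descend_functional l = (\<lambda>A \<in> carrier (quot G S \<phi>). SUP a \<in> A. l a)"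

lemma descend_functional_proj:
  assumes l: "l \<in> W_functionals S" and inv: "l \<in> invariant_functionals G (carrier S) \<phi>"
    and a: "a \<in> carrier S"
  shows "descend_functional l (proj a) = l a"
proof -
  have "a \<in> proj a"
    unfolding quot_map_def by (rule equiv_class_self[OF equiv_orbit_equiv a])
  then have "proj a \<noteq> {}" by blast
  then have "(SUP b \<in> proj a. l b) = l a"
  proof (rule SUP_eq_const)
    fix b assume "b \<in> proj a"
    then have "a \<le>\<^sub>G b" "b \<le>\<^sub>G a" by (auto simp: quot_map_def orbit_equiv_def)
    then show "l b = l a"
      using invariant_functional_orbit_leq[OF l inv] by (blast intro: antisym)
  qed
  then show ?thesis using proj_closed[OF a] by (simp add: descend_functional_def)
qed

text \<open>For the supremum condition, the elements below \<open>proj a\<close> include the images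
  of \<open>below S a\<close>, whose values already have supremum \<open>l a\<close>; monotonicity
  excludes larger values.\<close>

lemma descend_functional_mem:
  assumes l: "l \<in> W_functionals S" and inv: "l \<in> invariant_functionals G (carrier S) \<phi>"
  shows "descend_functional l \<in> W_functionals (quot G S \<phi>)"
proof -
  let ?Q = "quot G S \<phi>" and ?l = "descend_functional l"
  note desc = descend_functional_proj[OF l inv]
  have add: "l \<one>\<^bsub>S\<^esub> = 0" "\<And>a b. \<lbrakk>a \<in> carrier S; b \<in> carrier S\<rbrakk> \<Longrightarrow> l (a \<otimes>\<^bsub>S\<^esub> b) = l a + l b"
    using W_functionals_additive[OF l] by (simp_all add: additive_maps_def)
  have "?l (x \<otimes>\<^bsub>?Q\<^esub> y) = ?l x + ?l y" if x: "x \<in> carrier ?Q" and y: "y \<in> carrier ?Q" for x y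
  proof -
    obtain a where a: "a \<in> carrier S" "x = proj a" using x by (rule carrier_quotE)
    obtain b where b: "b \<in> carrier S" "y = proj b" using y by (rule carrier_quotE)
    show ?thesis using a b by (simp add: quot_mult desc add)
  qed
  then have "?l \<in> additive_maps ?Q"
    by (simp add: additive_maps_def quot_one desc add(1)) (simp add: descend_functional_def)
  moreover have mono: "?l x \<le> ?l y"
    if x: "x \<in> carrier ?Q" and y: "y \<in> carrier ?Q" and le: "below_leq ?Q x y" for x y
  proof -
    obtain a where a: "a \<in> carrier S" "x = proj a" using x by (rule carrier_quotE)
    obtain b where b: "b \<in> carrier S" "y = proj b" using y by (rule carrier_quotE)
    show ?thesis
      using a b le quot_below_leq[OF a(1) b(1)] invariant_functional_orbit_leq[OF l inv, of a b]
      by (simp add: desc)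
  qed
  moreover have "?l x = (SUP y \<in> below ?Q x. ?l y)" if x: "x \<in> carrier ?Q" for x
  proof (rule antisym)
    obtain a where a: "a \<in> carrier S" "x = proj a" using x by (rule carrier_quotE)
    have "l a = (SUP b \<in> below S a. l b)"
      using l a(1) unfolding W_functionals_def by blast
    also have "\<dots> \<le> (SUP y \<in> below ?Q x. ?l y)"
    proof (rule SUP_mono)
      fix b assume b: "b \<in> below S a"
      note bS = below_closed[OF b]
      have "proj b \<in> below ?Q x"
        using quot_below_iff[OF bS a(1)] b orb_leq_refl[OF bS] a(2) by auto
      then show "\<exists>y \<in> below ?Q x. l b \<le> ?l y"
        by (rule bexI[rotated]) (simp add: desc[OF bS])
    qed
    finally show "?l x \<le> (SUP y \<in> below ?Q x. ?l y)" using a by (simp add: desc)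
    show "(SUP y \<in> below ?Q x. ?l y) \<le> ?l x"
    proof (rule SUP_least)
      fix y assume y: "y \<in> below ?Q x"
      have "y \<in> carrier ?Q" using y by (simp add: below_def)
      moreover have "below_leq ?Q y x"
        by (rule W_semigroup.below_leq_of_below[OF W_semigroup_quot x y])
      ultimately show "?l y \<le> ?l x" using mono x by blast
    qed
  qed
  ultimately show ?thesis unfolding W_functionals_def by blast
qed

lemma bij_betw_compose_proj:
  "bij_betw (\<lambda>l. compose (carrier S) l proj) (W_functionals (quot G S \<phi>))
     (W_functionals S \<inter> invariant_functionals G (carrier S) \<phi>)"
proof (rule bij_betwI[where g = descend_functional])
  show "(\<lambda>l. compose (carrier S) l proj) \<in> W_functionals (quot G S \<phi>) \<rightarrow>
      W_functionals S \<inter> invariant_functionals G (carrier S) \<phi>"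
    using compose_proj_mem by blast
  show "descend_functional \<in> W_functionals S \<inter> invariant_functionals G (carrier S) \<phi> \<rightarrow>
      W_functionals (quot G S \<phi>)"
    using descend_functional_mem by blast
  show "descend_functional (compose (carrier S) l proj) = l" if l: "l \<in> W_functionals (quot G S \<phi>)" for l
  proof (rule extensionalityI)
    show "l \<in> extensional (carrier (quot G S \<phi>))"
      using l W_functionals_additive by (auto simp: additive_maps_def)
    fix x assume "x \<in> carrier (quot G S \<phi>)"
    then obtain a where a: "a \<in> carrier S" "x = proj a" by (rule carrier_quotE)
    then show "descend_functional (compose (carrier S) l proj) x = l x"
      using compose_proj_mem[OF l] descend_functional_proj by (simp add: compose_eq)
  qed (simp add: descend_functional_def)
  show "compose (carrier S) (descend_functional l) proj = l"
    if l: "l \<in> W_functionals S \<inter> invariant_functionals G (carrier S) \<phi>" for l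
  proof (rule extensionalityI)
    show "l \<in> extensional (carrier S)"
      using l W_functionals_additive by (auto simp: additive_maps_def)
    show "compose (carrier S) (descend_functional l) proj a = l a" if a: "a \<in> carrier S" for a
      using l a descend_functional_proj by (simp add: compose_eq)
  qed (simp add: compose_def)
qed

section \<open>Convergence under the quotient map and the second homeomorphism\<close>

text \<open>Forwards, \<open>proj\<close> preserves \<open>\<prec>\<close>. Backwards, an element
  below \<open>proj a\<close> is at most \<open>proj b\<close> for some \<open>b \<prec> a\<close>,
  and monotonicity of the functionals transfers the upper bound from \<open>b\<close>.\<close>

lemma functional_conv_compose_proj:
  assumes l: "l \<in> W_functionals (quot G S \<phi>)"
    and F: "eventually (\<lambda>f. f \<in> W_functionals (quot G S \<phi>)) F"
  shows "functional_conv (quot G S \<phi>) (\<lambda>f. f) l F \<longleftrightarrow>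
    functional_conv S (\<lambda>f. compose (carrier S) f proj) (compose (carrier S) l proj) F"
proof
  let ?Q = "quot G S \<phi>"
  assume conv: "functional_conv ?Q (\<lambda>f. f) l F"
  show "functional_conv S (\<lambda>f. compose (carrier S) f proj) (compose (carrier S) l proj) F"
    unfolding functional_conv_def
  proof (intro ballI)
    fix a b assume a: "a \<in> carrier S" and b: "b \<in> below S a"
    note bS = below_closed[OF b]
    have "proj b \<in> below ?Q (proj a)"
      using quot_below_iff[OF bS a] b orb_leq_refl[OF bS] by blast
    then have "Limsup F (\<lambda>f. f (proj b)) \<le> l (proj a) \<and> l (proj a) \<le> Liminf F (\<lambda>f. f (proj a))"
      using conv proj_closed[OF a] unfolding functional_conv_def by blast
    then show "Limsup F (\<lambda>f. compose (carrier S) f proj b) \<le> compose (carrier S) l proj a \<and>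
        compose (carrier S) l proj a \<le> Liminf F (\<lambda>f. compose (carrier S) f proj a)"
      using a bS by (simp add: compose_eq)
  qed
next
  let ?Q = "quot G S \<phi>"
  assume *: "functional_conv S (\<lambda>f. compose (carrier S) f proj) (compose (carrier S) l proj) F"
  have conv: "Limsup F (\<lambda>f. f (proj b)) \<le> l (proj a)" "l (proj a) \<le> Liminf F (\<lambda>f. f (proj a))"
    if "a \<in> carrier S" "b \<in> below S a" for a b
    using *[unfolded functional_conv_def, rule_format, OF that] that(1) below_closed[OF that(2)]
    by (simp_all add: compose_eq)
  show "functional_conv ?Q (\<lambda>f. f) l F"
    unfolding functional_conv_def
  proof (intro ballI conjI)
    fix x y assume x: "x \<in> carrier ?Q" and y: "y \<in> below ?Q x"
    have yQ: "y \<in> carrier ?Q" using y by (simp add: below_def)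
    obtain a where a: "a \<in> carrier S" "x = proj a" using x by (rule carrier_quotE)
    obtain c where c: "c \<in> carrier S" "y = proj c" using yQ by (rule carrier_quotE)
    obtain b where b: "b \<in> below S a" "c \<le>\<^sub>G b"
      using y quot_below_iff[OF c(1) a(1)] a c by auto
    note bS = below_closed[OF b(1)]
    have "below_leq ?Q y (proj b)" using b(2) c(2) quot_below_leq[OF c(1) bS] by simp
    then have le: "f y \<le> f (proj b)" if "f \<in> W_functionals ?Q" for f
      using that yQ proj_closed[OF bS] unfolding W_functionals_def by blast
    have "Limsup F (\<lambda>f. f y) \<le> Limsup F (\<lambda>f. f (proj b))"
      by (rule Limsup_mono, use F in eventually_elim) (rule le)
    also have "\<dots> \<le> l x" using conv(1)[OF a(1) b(1)] a(2) by simp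
    finally show "Limsup F (\<lambda>f. f y) \<le> l x" .
    show "l x \<le> Liminf F (\<lambda>f. f x)" using conv(2)[OF a(1) b(1)] a(2) by simp
  qed
qed

text \<open>Brings the space of invariant functionals into the form to which
  \<open>homeomorphic_map_functional_topology\<close> applies.\<close>

lemma subtopology_W_functional_space:
  "subtopology (W_functional_space S) I = functional_topology S (W_functionals S \<inter> I)"
  unfolding W_functional_space_def
  by (rule subtopology_functional_topology) (rule W_functionals_mono)

theorem affine_homeomorphism_quot:
  "affine_homeomorphism (carrier (quot G S \<phi>)) (W_functional_space (quot G S \<phi>)) (carrier S)
     (subtopology (W_functional_space S) (invariant_functionals G (carrier S) \<phi>))
     (\<lambda>l. compose (carrier S) l proj)"
  unfolding affine_homeomorphism_def subtopology_W_functional_space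
  unfolding W_functional_space_def
  by (intro conjI ballI allI impI homeomorphic_map_functional_topology bij_betw_compose_proj
      functional_conv_compose_proj compose_cone_comb proj_closed)

end

section \<open>Functionals on Cu-semigroups\<close>

context Cu_semigroup
begin

section \<open>The way-below relation and the functionals it defines\<close>

lemma leq_refl: "a \<in> carrier T \<Longrightarrow> a \<preceq>\<^bsub>T\<^esub> a"
  using partial_order.axioms(1)[OF poset] weak_partial_order.le_refl by (fastforce simp: poset_of_def)

lemma leq_trans:
  assumes "a \<in> carrier T" "b \<in> carrier T" "c \<in> carrier T" "a \<preceq>\<^bsub>T\<^esub> b" "b \<preceq>\<^bsub>T\<^esub> c"
  shows "a \<preceq>\<^bsub>T\<^esub> c"
proof -
  interpret P: partial_order "poset_of T" by (rule poset)
  show ?thesis using P.le_trans[of a b c] assms by (simp add: poset_of_def)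
qed

text \<open>The constant sequence at \<open>a\<close> has supremum \<open>a\<close>.\<close>

lemma way_below_imp_leq:
  assumes a: "a \<in> carrier T" and ba: "way_below T b a"
  shows "b \<preceq>\<^bsub>T\<^esub> a"
proof -
  have "incr_seq T (\<lambda>_. a)" "is_sup T (\<lambda>_. a) a"
    using a by (auto simp: incr_seq_def is_sup_iff leq_refl)
  then show ?thesis
    using ba leq_refl[OF a] unfolding way_below_def by blast
qed

lemma way_below_leq_trans:
  assumes "a \<in> carrier T" "b \<in> carrier T" "way_below T c a" "a \<preceq>\<^bsub>T\<^esub> b"
  shows "way_below T c b"
  unfolding way_below_def
proof (intro allI impI)
  fix s x assume s: "incr_seq T s \<and> is_sup T s x \<and> b \<preceq>\<^bsub>T\<^esub> x"
  then have "a \<preceq>\<^bsub>T\<^esub> x"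
    using leq_trans[of a b x] assms by (simp add: is_sup_iff)
  then show "\<exists>n. c \<preceq>\<^bsub>T\<^esub> s n"
    using s assms(3) unfolding way_below_def by blast
qed

lemma below_way_below_monoid:
  "b \<in> below (way_below_monoid T) a \<longleftrightarrow> b \<in> carrier T \<and> way_below T b a"
  by (simp add: below_def way_below_monoid_def)

lemma rapid_seq:
  assumes "a \<in> carrier T"
  shows "\<exists>s. incr_seq T s \<and> is_sup T s a \<and> (\<forall>n. s n \<in> below (way_below_monoid T) a)"
proof -
  obtain s where s: "\<And>k. s k \<in> carrier T" "\<And>k. way_below T (s k) (s (Suc k))" "is_sup T s a"
    using O2[OF assms] by blast
  have "way_below T (s k) a" for k
    by (rule way_below_leq_trans[OF s(1) assms s(2)]) (use s in \<open>simp add: is_sup_iff\<close>)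
  then show ?thesis
    using s by (intro exI[of _ s]) (simp add: incr_seq_def below_way_below_monoid way_below_imp_leq)
qed

text \<open>By (O2) an element is the supremum of elements way below it, so \<open>\<lless>\<close>
  determines the order.\<close>

lemma below_leq_way_below_monoid:
  assumes a: "a \<in> carrier T" and b: "b \<in> carrier T"
  shows "below_leq (way_below_monoid T) a b \<longleftrightarrow> a \<preceq>\<^bsub>T\<^esub> b"
proof
  assume le: "below_leq (way_below_monoid T) a b"
  obtain s where s: "is_sup T s a" "\<And>n. s n \<in> below (way_below_monoid T) a"
    using rapid_seq[OF a] by blast
  have "s n \<in> below (way_below_monoid T) b" for n
    using s(2) le unfolding below_leq_def by blast
  then show "a \<preceq>\<^bsub>T\<^esub> b"
    by (intro is_sup_least[OF s(1) b]) (simp add: below_way_below_monoid way_below_imp_leq b)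
next
  assume "a \<preceq>\<^bsub>T\<^esub> b"
  then show "below_leq (way_below_monoid T) a b"
    using way_below_leq_trans[OF a b] by (auto simp: below_leq_def below_way_below_monoid)
qed

text \<open>Preservation of suprema, applied to a sequence from \<open>rapid_seq\<close>, yields the
  supremum condition. Conversely, whatever is way below the supremum of an increasing sequence is
  dominated by one of its terms.\<close>

lemma Cu_functionals_eq_W_functionals: "Cu_functionals T = W_functionals (way_below_monoid T)"
proof (intro equalityI subsetI)
  let ?W = "way_below_monoid T"
  have add: "additive_maps T = additive_maps ?W" and car: "carrier ?W = carrier T"
    by (simp_all add: additive_maps_def way_below_monoid_def)
  {
    fix l assume l: "l \<in> Cu_functionals T"
    have "l a = (SUP b \<in> below ?W a. l b)" if a: "a \<in> carrier T" for a
    proof (rule antisym)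
      obtain s where s: "incr_seq T s" "is_sup T s a" "\<And>n. s n \<in> below ?W a"
        using rapid_seq[OF a] by blast
      have "l a = (SUP n. l (s n))" by (rule Cu_functionalsD(3)[OF l s(1,2)])
      also have "\<dots> \<le> (SUP b \<in> below ?W a. l b)"
        using s(3) by (intro SUP_least SUP_upper)
      finally show "l a \<le> (SUP b \<in> below ?W a. l b)" .
      show "(SUP b \<in> below ?W a. l b) \<le> l a"
        by (rule SUP_least)
          (simp add: below_way_below_monoid Cu_functionalsD(2)[OF l] a way_below_imp_leq)
    qed
    then show "l \<in> W_functionals ?W"
      using Cu_functionalsD(1,2)[OF l] below_leq_way_below_monoid add
      unfolding W_functionals_def car by blast
  next
    fix l assume l: "l \<in> W_functionals ?W"
    have mono: "l a \<le> l b" if "a \<in> carrier T" "b \<in> carrier T" "a \<preceq>\<^bsub>T\<^esub> b" for a b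
      using l that below_leq_way_below_monoid unfolding W_functionals_def car by blast
    have "l x = (SUP n. l (s n))" if s: "incr_seq T s" and x: "is_sup T s x" for s x
    proof (rule antisym)
      have xT: "x \<in> carrier T" and sT: "\<And>n. s n \<in> carrier T" and sx: "\<And>n. s n \<preceq>\<^bsub>T\<^esub> x"
        using s x by (simp_all add: is_sup_iff incr_seq_def)
      have "l x = (SUP b \<in> below ?W x. l b)"
        using l xT unfolding W_functionals_def car by blast
      also have "\<dots> \<le> (SUP n. l (s n))"
      proof (rule SUP_mono)
        fix b assume b: "b \<in> below ?W x"
        then obtain n where "b \<preceq>\<^bsub>T\<^esub> s n"
          using s x leq_refl[OF xT] unfolding below_way_below_monoid way_below_def by blast
        then show "\<exists>n \<in> UNIV. l b \<le> l (s n)"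
          using mono[of b "s n"] b sT[of n] unfolding below_way_below_monoid by blast
      qed
      finally show "l x \<le> (SUP n. l (s n))" .
      show "(SUP n. l (s n)) \<le> l x"
        by (rule SUP_least) (rule mono[OF sT xT sx])
    qed
    then show "l \<in> Cu_functionals T"
      using l mono add unfolding Cu_functionals_def W_functionals_def by blast
  }
qed

lemma Cu_functional_space_eq: "Cu_functional_space T = W_functional_space (way_below_monoid T)"
  by (simp add: Cu_functional_space_def W_functional_space_def Cu_functionals_eq_W_functionals)

end

theorem proposition11p2:
  fixes S :: "'a prec_monoid"
    and T :: "'b leq_monoid"
    and G :: "('g, 'n) monoid_scheme"
    and \<phi> :: "'g \<Rightarrow> 'a \<Rightarrow> 'a"
    and \<psi> :: "'g \<Rightarrow> 'b \<Rightarrow> 'b"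
  shows
    "(W_semigroup S \<longrightarrow>
        (\<exists>h. affine_homeomorphism
               (carrier S) (W_functional_space S)
               (carrier (Cu_completion S)) (Cu_functional_space (Cu_completion S)) h)) \<and>
     (G_W_semigroup G S \<phi> \<longrightarrow>
        affine_homeomorphism
          (carrier (quot G S \<phi>)) (W_functional_space (quot G S \<phi>))
          (carrier S)
          (subtopology (W_functional_space S) (invariant_functionals G (carrier S) \<phi>))
          (\<lambda>l. compose (carrier S) l (quot_map G S \<phi>))) \<and>
     (G_Cu_semigroup G T \<psi> \<longrightarrow>
        (\<exists>h. affine_homeomorphism
               (carrier (Cu_completion (quot G (way_below_monoid T) \<psi>)))
               (Cu_functional_space (Cu_completion (quot G (way_below_monoid T) \<psi>)))
               (carrier T)
               (subtopology (Cu_functional_space T) (invariant_functionals G (carrier T) \<psi>)) h))"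
proof (intro conjI impI)
  assume "W_semigroup S"
  then show "\<exists>h. affine_homeomorphism (carrier S) (W_functional_space S)
      (carrier (Cu_completion S)) (Cu_functional_space (Cu_completion S)) h"
    by (rule W_semigroup.affine_homeomorphism_completion)
next
  assume "G_W_semigroup G S \<phi>"
  then show "affine_homeomorphism (carrier (quot G S \<phi>)) (W_functional_space (quot G S \<phi>)) (carrier S)
      (subtopology (W_functional_space S) (invariant_functionals G (carrier S) \<phi>))
      (\<lambda>l. compose (carrier S) l (quot_map G S \<phi>))"
    by (rule G_W_semigroup.affine_homeomorphism_quot)
next
  let ?W = "way_below_monoid T"
  assume "G_Cu_semigroup G T \<psi>"
  then have T: "Cu_semigroup T" and W: "G_W_semigroup G ?W \<psi>"
    by (simp_all add: G_Cu_semigroup_def)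
  have "carrier ?W = carrier T" by (simp add: way_below_monoid_def)
  \<comment> \<open>Restriction along \<open>embed\<close> for the quotient, followed by composition
    with the quotient map, leads to the invariant functionals on \<open>?W\<close>, whose ambient
    space is that of the Cu-functionals on \<open>T\<close>.\<close>
  with affine_homeomorphism_compose[
      OF W_semigroup.affine_homeomorphism_restrict[OF G_W_semigroup.W_semigroup_quot[OF W]]
        G_W_semigroup.affine_homeomorphism_quot[OF W]]
  show "\<exists>h. affine_homeomorphism (carrier (Cu_completion (quot G ?W \<psi>)))
      (Cu_functional_space (Cu_completion (quot G ?W \<psi>))) (carrier T)
      (subtopology (Cu_functional_space T) (invariant_functionals G (carrier T) \<psi>)) h"
    unfolding Cu_semigroup.Cu_functional_space_eq[OF T] by auto
qed

end
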